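(* (a) Let $F$ be a bi-freely max-infinitely divisible bivariate distribution function and $\mathbf{L}=(L_1,L_2)=\inf\mathrm{supp}(F)$. Then for any $t>0$ the function $$G(\mathbf{x})=\begin{cases}\exp[-t\,T_F(\mathbf{x})],&\mathbf{x}\in[L_1,\infty)\times[L_2,\infty),\\ 0,&\text{otherwise},\end{cases}$$ is a max-infinitely divisible distribution function on $\mathbb{R}^2$. (b) Conversely, if $G$ is a max-infinitely divisible bivariate distribution function satisfying $\{G>0\}=[L_1,\infty)\times[L_2,\infty)$ for some $\mathbf{L}=(L_1,L_2)\in\mathbb{R}^2$, then there exist $t>0$ and a bi-freely max-infinitely divisible bivariate distribution function $F$ with $\inf\mathrm{supp}(F)=\mathbf{L}$ such that $G$ has the form displayed in (a).
   Context: A bivariate distribution function is $F(x_1,x_2)=\mu((-\infty,x_1]\times(-\infty,x_2])$ for a Borel probability measure $\mu$ on $\mathbb{R}^2$; $F_1,F_2$ denote its marginal distribution functions. $c_+=\max\{c,0\}$. Bi-free max-convolution: for bivariate distribution functions $F,G$, $H=F\star G$ is the (unique) bivariate distribution function with marginals $H_j=(F_j+G_j-1)_+$ on $\mathbb{R}$, $j=1,2$, and such that $\frac{H_1H_2}{H}=\frac{F_1F_2}{F}+\frac{G_1G_2}{G}-1$ at each $\mathbf{x}$ where $F(\mathbf{x}),G(\mathbf{x}),H_1(x_1),H_2(x_2)$ are all strictly positive, and $H(\mathbf{x})=0$ at all other $\mathbf{x}$. The operation is well defined, commutative and associative; $F^{\star n}$ is the $n$-fold convolution of $F$ with itself. $F$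 is bi-freely max-infinitely divisible if for every $n\in\mathbb{N}$ there is a bivariate distribution function $F^{(1/n)}$ with $(F^{(1/n)})^{\star n}=F$. If $F$ is bi-freely max-infinitely divisible, then $\{F>0\}=\{F_1>0\}\times\{F_2>0\}$ and this set is one of $(L_1,\infty)\times(L_2,\infty)$, $(L_1,\infty)\times[L_2,\infty)$, $[L_1,\infty)\times(L_2,\infty)$, $[L_1,\infty)\times[L_2,\infty)$ for some $\mathbf{L}=(L_1,L_2)\in\mathbb{R}^2$, denoted $\inf\mathrm{supp}(F)$. On $\{F>0\}$ put $T_F=\frac{F_1F_2}{F}-F_1-F_2+1$; for such $F$, $T_F$ extends by continuity from above to $[L_1,\infty)\times[L_2,\infty)$, and the extension is again denoted $T_F$. A bivariate distribution function $G$ is max-infinitely divisible (in the classical sense) if the pointwise power $G^{1/n}$ is a bivariate distribution function for every $n\in\mathbb{N}$. *)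

theory Defs
  imports "HOL-Probability.Probability"
begin

section \<open>Bivariate distribution functions\<close>

definition bcdf :: "(real \<times> real) measure \<Rightarrow> real \<times> real \<Rightarrow> real" where
  "bcdf M x = measure M ({..fst x} \<times> {..snd x})"

definition bivariate_df :: "(real \<times> real \<Rightarrow> real) \<Rightarrow> bool" where
  "bivariate_df F \<longleftrightarrow> (\<exists>M. prob_space M \<and> sets M = sets borel \<and> F = bcdf M)"

text \<open>For a bivariate distribution function these are the distribution functions of the
  two marginal laws, see \<open>marginal1_bcdf\<close> and \<open>marginal2_bcdf\<close> below.\<close>

definition marginal1 :: "(real \<times> real \<Rightarrow> real) \<Rightarrow> real \<Rightarrow> real" where
  "marginal1 F x1 = Lim at_top (\<lambda>x2. F (x1, x2))"

definition marginal2 :: "(real \<times> real \<Rightarrow> real) \<Rightarrow> real \<Rightarrow> real" where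
  "marginal2 F x2 = Lim at_top (\<lambda>x1. F (x1, x2))"

lemma marginal1_bcdf:
  assumes "prob_space M" and sets: "sets M = sets (borel :: (real \<times> real) measure)"
  shows "marginal1 (bcdf M) x = cdf (distr M borel fst) x"
proof -
  interpret prob_space M by fact
  have sp: "space M = UNIV" using sets_eq_imp_space_eq[OF sets] by simp
  have m: "fst \<in> borel_measurable M"
    using sets by (simp add: measurable_cong_sets[OF sets refl] borel_measurable_continuous_onI
        continuous_on_fst)
  have "(\<lambda>n. measure M ({..x} \<times> {..real n})) \<longlonglongrightarrow> measure M (\<Union>n. {..x} \<times> {..real n})"
    by (rule finite_Lim_measure_incseq) (auto simp: sets incseq_def intro!: borel_closed closed_Times)
  also have "(\<Union>n. {..x} \<times> {..real n}) = {..x} \<times> UNIV"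
    using real_arch_simple by fastforce
  finally have 1: "(\<lambda>n. bcdf M (x, real n)) \<longlonglongrightarrow> measure M ({..x} \<times> UNIV)"
    by (simp add: bcdf_def)
  have mono: "bcdf M (x, a) \<le> bcdf M (x, b)" if "a \<le> b" for a b
    unfolding bcdf_def using that
    by (intro finite_measure_mono) (auto simp: sets intro!: borel_closed closed_Times)
  have "((\<lambda>y. bcdf M (x, y)) \<longlongrightarrow> measure M ({..x} \<times> UNIV)) at_top"
    by (rule tendsto_at_topI_sequentially_real) (use 1 mono in \<open>auto simp: mono_def\<close>)
  then have "marginal1 (bcdf M) x = measure M ({..x} \<times> UNIV)"
    unfolding marginal1_def by (intro tendsto_Lim) auto
  moreover have "fst -` {..x} \<inter> space M = {..x} \<times> (UNIV :: real set)"
    by (auto simp: sp)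
  ultimately show ?thesis
    using m by (simp add: cdf_def measure_distr)
qed

lemma marginal2_bcdf:
  assumes "prob_space M" and sets: "sets M = sets (borel :: (real \<times> real) measure)"
  shows "marginal2 (bcdf M) x = cdf (distr M borel snd) x"
proof -
  interpret prob_space M by fact
  have sp: "space M = UNIV" using sets_eq_imp_space_eq[OF sets] by simp
  have m: "snd \<in> borel_measurable M"
    using sets by (simp add: measurable_cong_sets[OF sets refl] borel_measurable_continuous_onI
        continuous_on_snd)
  have "(\<lambda>n. measure M ({..real n} \<times> {..x})) \<longlonglongrightarrow> measure M (\<Union>n. {..real n} \<times> {..x})"
    by (rule finite_Lim_measure_incseq) (auto simp: sets incseq_def intro!: borel_closed closed_Times)
  also have "(\<Union>n. {..real n} \<times> {..x}) = UNIV \<times> {..x}"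
    using real_arch_simple by fastforce
  finally have 1: "(\<lambda>n. bcdf M (real n, x)) \<longlonglongrightarrow> measure M (UNIV \<times> {..x})"
    by (simp add: bcdf_def)
  have mono: "bcdf M (a, x) \<le> bcdf M (b, x)" if "a \<le> b" for a b
    unfolding bcdf_def using that
    by (intro finite_measure_mono) (auto simp: sets intro!: borel_closed closed_Times)
  have "((\<lambda>y. bcdf M (y, x)) \<longlongrightarrow> measure M (UNIV \<times> {..x})) at_top"
    by (rule tendsto_at_topI_sequentially_real) (use 1 mono in \<open>auto simp: mono_def\<close>)
  then have "marginal2 (bcdf M) x = measure M (UNIV \<times> {..x})"
    unfolding marginal2_def by (intro tendsto_Lim) auto
  moreover have "snd -` {..x} \<inter> space M = (UNIV :: real set) \<times> {..x}"
    by (auto simp: sp)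
  ultimately show ?thesis
    using m by (simp add: cdf_def measure_distr)
qed

definition max_infdiv :: "(real \<times> real \<Rightarrow> real) \<Rightarrow> bool" where
  "max_infdiv G \<longleftrightarrow> bivariate_df G \<and>
     (\<forall>n::nat. n \<ge> 1 \<longrightarrow> bivariate_df (\<lambda>x. G x powr (1 / real n)))"

section \<open>Bi-free max-convolution\<close>

text \<open>The convolution is rendered as a relation: \<open>H\<close> is the bi-free max-convolution of the
  distribution functions \<open>F\<close> and \<open>G\<close>. There is at most one such \<open>H\<close>, see
  \<open>bifree_max_conv_unique\<close> below.\<close>

definition bifree_max_conv ::
  "(real \<times> real \<Rightarrow> real) \<Rightarrow> (real \<times> real \<Rightarrow> real) \<Rightarrow> (real \<times> real \<Rightarrow> real) \<Rightarrow> bool" where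
  "bifree_max_conv F G H \<longleftrightarrow>
     bivariate_df F \<and> bivariate_df G \<and> bivariate_df H \<and>
     (\<forall>x. marginal1 H x = max (marginal1 F x + marginal1 G x - 1) 0) \<and>
     (\<forall>x. marginal2 H x = max (marginal2 F x + marginal2 G x - 1) 0) \<and>
     (\<forall>x. if F x > 0 \<and> G x > 0 \<and> marginal1 H (fst x) > 0 \<and> marginal2 H (snd x) > 0
           then H x > 0 \<and>
             marginal1 H (fst x) * marginal2 H (snd x) / H x =
               marginal1 F (fst x) * marginal2 F (snd x) / F x +
               marginal1 G (fst x) * marginal2 G (snd x) / G x - 1
           else H x = 0)"

lemma bifree_max_conv_unique:
  assumes H: "bifree_max_conv F G H" and K: "bifree_max_conv F G K"
  shows "H = K"
proof
  fix x
  have m1: "marginal1 H (fst x) = marginal1 K (fst x)"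
   and m2: "marginal2 H (snd x) = marginal2 K (snd x)"
    using H K by (simp_all add: bifree_max_conv_def)
  let ?P = "F x > 0 \<and> G x > 0 \<and> marginal1 H (fst x) > 0 \<and> marginal2 H (snd x) > 0"
  show "H x = K x"
  proof (cases ?P)
    case True
    have "H x > 0" "K x > 0"
      "marginal1 H (fst x) * marginal2 H (snd x) / H x =
       marginal1 H (fst x) * marginal2 H (snd x) / K x"
      using H K True m1 m2 unfolding bifree_max_conv_def by metis+
    then show ?thesis using True by auto
  next
    case False
    then have "H x = 0" "K x = 0"
      using H K m1 m2 unfolding bifree_max_conv_def by metis+
    then show ?thesis by simp
  qed
qed

text \<open>\<open>bifree_max_power F n H\<close> says that \<open>H\<close> is the \<open>n\<close>-fold convolution of \<open>F\<close> with itself,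
  for \<open>n \<ge> 1\<close>.\<close>

inductive bifree_max_power ::
  "(real \<times> real \<Rightarrow> real) \<Rightarrow> nat \<Rightarrow> (real \<times> real \<Rightarrow> real) \<Rightarrow> bool" for F where
  one: "bifree_max_power F 1 F"
| Suc: "bifree_max_power F n H \<Longrightarrow> bifree_max_conv H F K \<Longrightarrow> bifree_max_power F (Suc n) K"

definition bifree_max_infdiv :: "(real \<times> real \<Rightarrow> real) \<Rightarrow> bool" where
  "bifree_max_infdiv F \<longleftrightarrow> bivariate_df F \<and>
     (\<forall>n::nat. n \<ge> 1 \<longrightarrow> (\<exists>R. bivariate_df R \<and> bifree_max_power R n F))"

section \<open>The lower corner of the support and the function \<open>T\<^sub>F\<close>\<close>

definition supp_corner :: "(real \<times> real \<Rightarrow> real) \<Rightarrow> real \<times> real \<Rightarrow> bool" where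
  "supp_corner F L \<longleftrightarrow>
     {x. F x > 0} \<in> {{fst L<..} \<times> {snd L<..}, {fst L<..} \<times> {snd L..},
                     {fst L..} \<times> {snd L<..}, {fst L..} \<times> {snd L..}}"

lemma supp_corner_unique:
  assumes "supp_corner F L" "supp_corner F L'"
  shows "L = L'"
proof -
  have inf: "Inf (fst ` {x. F x > 0}) = fst L \<and> Inf (snd ` {x. F x > 0}) = snd L"
    if "supp_corner F L" for L
    using that unfolding supp_corner_def insert_iff empty_iff
    by (elim disjE FalseE) (simp_all add: fst_image_times snd_image_times)
  show ?thesis using inf[OF assms(1)] inf[OF assms(2)] by (simp add: prod_eq_iff)
qed

text \<open>Meaningful when the positivity set has one of the four shapes in \<open>supp_corner\<close>, as is
  the case for bi-freely max-infinitely divisible \<open>F\<close>.\<close>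

definition inf_supp :: "(real \<times> real \<Rightarrow> real) \<Rightarrow> real \<times> real" where
  "inf_supp F = (THE L. supp_corner F L)"

definition T_pos :: "(real \<times> real \<Rightarrow> real) \<Rightarrow> real \<times> real \<Rightarrow> real" where
  "T_pos F x = marginal1 F (fst x) * marginal2 F (snd x) / F x
               - marginal1 F (fst x) - marginal2 F (snd x) + 1"

text \<open>The extension of \<open>T_pos F\<close> from the positivity set by continuity from above; it is only
  used on the closed quadrant with lower corner \<open>inf_supp F\<close>.\<close>

definition T_fun :: "(real \<times> real \<Rightarrow> real) \<Rightarrow> real \<times> real \<Rightarrow> real" where
  "T_fun F x =
     (if F x > 0 then T_pos F x
      else Lim (at x within {y. F y > 0 \<and> fst x \<le> fst y \<and> snd x \<le> snd y}) (T_pos F))"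

definition exp_T :: "real \<Rightarrow> (real \<times> real \<Rightarrow> real) \<Rightarrow> real \<times> real \<Rightarrow> real \<times> real \<Rightarrow> real" where
  "exp_T t F L x = (if x \<in> {fst L..} \<times> {snd L..} then exp (- t * T_fun F x) else 0)"

end

theory Submission
  imports Defs
begin

text \<open>
  Two facts carry both directions.  First, a real function on the plane is a bivariate distribution
  function as soon as it is 2-increasing (nonnegative increments over rectangles), continuous from the
  right in each variable, and has the right limits at infinity
  (\<open>bivariate_df_of_2_increasing\<close>).  Second, both notions of infinite divisibility linearise in the
  limit.  If \<open>R n\<close> is the \<open>n\<close>-th bi-free root of \<open>F\<close>, then \<open>n * (1 - R n)\<close> tends to \<open>T_pos F\<close> on
  the positivity set of \<open>F\<close> (\<open>T_pos_limit_of_roots\<close>); likewise \<open>n * (1 - G powr (1 / n))\<close> tends to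
  \<open>- ln G\<close>.  Since \<open>R n\<close> and \<open>G powr (1 / n)\<close> are distribution functions, both \<open>- T_pos F\<close> and
  \<open>ln G\<close> are monotone and 2-increasing.

  From \<open>F\<close> to \<open>G\<close>: order properties and bounds survive the extension of \<open>T_pos F\<close> from above to the
  closed quadrant, and the exponential of a monotone 2-increasing function is 2-increasing.  Hence
  \<open>exp (- t * T_fun F)\<close> is a distribution function for every \<open>t > 0\<close>, and so are its roots, which
  have the same form with \<open>t / n\<close> in place of \<open>t\<close>.

  From \<open>G\<close> to \<open>F\<close>: with \<open>V = - ln G\<close> and its marginal limits \<open>V1\<close>, \<open>V2\<close>, the equation
  \<open>T_pos F = V / t\<close> has the explicit solution with marginals \<open>1 - V1 / t\<close>, \<open>1 - V2 / t\<close> and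
  \<open>F = (1 - V1 / t) * (1 - V2 / t) / (1 - (V1 + V2 - V) / t)\<close>.  For large \<open>t\<close> this is a distribution
  function, by an elementary inequality (\<open>bifree_quotient_2_increasing\<close>).  Convolving two such
  functions adds the reciprocals of their parameters, so the solution for \<open>n * t\<close> is an \<open>n\<close>-th root
  of the solution for \<open>t\<close>.
\<close>

section \<open>Dominated distribution functions on the line\<close>

text \<open>
  The distribution functions of finite Borel measures on the line, of any total mass:
  differences of distribution functions occur below, and their mass need not be one.
\<close>

definition finite_measure_df :: "(real \<Rightarrow> real) \<Rightarrow> bool" where
  "finite_measure_df f \<longleftrightarrow> mono f \<and> (\<forall>a. continuous (at_right a) f) \<and> (f \<longlongrightarrow> 0) at_bot \<and>
     (\<exists>m. (f \<longlongrightarrow> m) at_top)"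

lemma finite_measure_df_nonneg: "finite_measure_df f \<Longrightarrow> 0 \<le> f x"
  unfolding finite_measure_df_def
  by (rule tendsto_upperbound[of f 0 at_bot])
     (auto simp: eventually_at_bot_linorder mono_def intro!: exI[of _ x])

lemma finite_borel_interval_measure_finite_measure_df:
  assumes "finite_measure_df f"
  shows "finite_borel_measure (interval_measure f)"
proof -
  obtain m where m: "(f \<longlongrightarrow> m) at_top" using assms by (auto simp: finite_measure_df_def)
  have "0 \<le> m"
    using m by (rule tendsto_lowerbound) (auto simp: finite_measure_df_nonneg[OF assms])
  then show ?thesis
    using assms m by (intro finite_borel_measure_interval_measure) (auto simp: finite_measure_df_def mono_def)
qed

lemma emeasure_interval_measure_finite_measure_df_Iic:
  "finite_measure_df f \<Longrightarrow> emeasure (interval_measure f) {..x} = ennreal (f x)"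
  by (intro emeasure_interval_measure_Iic) (auto simp: finite_measure_df_def mono_def)

lemma finite_borel_measure_eqI:
  assumes M: "finite_borel_measure M" and N: "sets N = sets borel"
    and eq: "\<And>x. emeasure N {..x} = emeasure M {..x}"
  shows "N = M"
proof (rule cdf_unique')
  interpret M: finite_borel_measure M by fact
  have "emeasure N (\<Union>n. {..real n}) \<le> emeasure M UNIV"
  proof (rule LIMSEQ_le_const2[OF Lim_emeasure_incseq])
    show "\<exists>K. \<forall>n\<ge>K. emeasure N {..real n} \<le> emeasure M UNIV"
      by (simp add: eq emeasure_space flip: M.borel_UNIV)
  qed (auto simp: N incseq_def)
  also have "(\<Union>n. {..real n}) = UNIV" using real_arch_simple by auto
  finally have "emeasure N UNIV \<le> emeasure M UNIV" .
  then have "emeasure N UNIV < \<infinity>"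
    using M.emeasure_finite[of UNIV] by (metis infinity_ennreal_def le_less_trans less_top)
  then show "finite_borel_measure N"
    using N sets_eq_imp_space_eq[OF N]
    by (intro finite_borel_measure.intro finite_measureI finite_borel_measure_axioms.intro) auto
  show "cdf N = cdf M" by (simp add: cdf_def measure_def eq fun_eq_iff)
qed fact

text \<open>
  Its use is the comparison of measures: if both \<open>f\<close> and \<open>h - f\<close> are distribution functions,
  then the measure of \<open>f\<close> is dominated by that of \<open>h\<close> on every Borel set, not only on intervals.
\<close>

lemma interval_measure_add:
  assumes f: "finite_measure_df f" and g: "finite_measure_df g" and h: "finite_measure_df h"
    and eq: "\<And>x. h x = f x + g x"
    and A: "A \<in> sets borel"
  shows "emeasure (interval_measure h) A =
    emeasure (interval_measure f) A + emeasure (interval_measure g) A"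
proof -
  define N where "N = measure_of UNIV (sets borel)
    (\<lambda>A. emeasure (interval_measure f) A + emeasure (interval_measure g) A)"
  have sN: "sets N = sets borel"
    unfolding N_def by (simp add: sets_measure_of sets.sigma_sets_eq[of borel, simplified])
  have eN: "emeasure N B = emeasure (interval_measure f) B + emeasure (interval_measure g) B"
    if B: "B \<in> sets borel" for B
  proof (rule emeasure_measure_of[OF N_def])
    show "countably_additive (sets N)
      (\<lambda>A. emeasure (interval_measure f) A + emeasure (interval_measure g) A)"
      by (rule countably_additiveI)
         (auto simp: sN suminf_add[symmetric] suminf_emeasure subset_eq)
  qed (auto simp: sN B positive_def)
  have "N = interval_measure h"
    by (rule finite_borel_measure_eqI[OF finite_borel_interval_measure_finite_measure_df[OF h] sN])
       (simp add: eN emeasure_interval_measure_finite_measure_df_Iic f g h eq finite_measure_df_nonneg)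
  then show ?thesis using eN[OF A] by simp
qed

lemma density_of_dominated_finite_measure_df:
  assumes f: "finite_measure_df f" and h: "finite_measure_df h"
    and d: "finite_measure_df (\<lambda>x. h x - f x)"
  obtains g where "g \<in> borel_measurable borel" "density (interval_measure h) g = interval_measure f"
proof -
  interpret finite_borel_measure "interval_measure h"
    by (rule finite_borel_interval_measure_finite_measure_df[OF h])
  have "absolutely_continuous (interval_measure h) (interval_measure f)"
    by (auto simp: absolutely_continuous_def null_sets_def interval_measure_add[OF f d h])
  from density_RN_deriv[OF this]
  show ?thesis by (intro that[of "RN_deriv (interval_measure h) (interval_measure f)"]) auto
qed

text \<open>
  Densities are unique almost everywhere, so \<open>k\<close> must be the sum of \<open>g\<close> and a nonnegative
  density of \<open>h - f\<close>.
\<close>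

lemma density_mono_finite_measure_df:
  assumes m: "finite_measure_df m" and f: "finite_measure_df f" and h: "finite_measure_df h"
    and d: "finite_measure_df (\<lambda>x. h x - f x)"
    and mh: "finite_measure_df (\<lambda>x. m x - h x)" and md: "finite_measure_df (\<lambda>x. m x - (h x - f x))"
    and g: "g \<in> borel_measurable borel" "density (interval_measure m) g = interval_measure f"
    and k: "k \<in> borel_measurable borel" "density (interval_measure m) k = interval_measure h"
  shows "AE x in interval_measure m. g x \<le> k x"
proof -
  interpret M: finite_borel_measure "interval_measure m"
    by (rule finite_borel_interval_measure_finite_measure_df[OF m])
  obtain e where e: "e \<in> borel_measurable borel"
    "density (interval_measure m) e = interval_measure (\<lambda>x. h x - f x)"
    using density_of_dominated_finite_measure_df[OF d m md] .
  have "density (interval_measure m) (\<lambda>x. g x + e x) = interval_measure h"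
  proof (rule measure_eqI)
    fix A assume "A \<in> sets (density (interval_measure m) (\<lambda>x. g x + e x))"
    then have A: "A \<in> sets borel" by simp
    have "emeasure (density (interval_measure m) (\<lambda>x. g x + e x)) A =
      emeasure (density (interval_measure m) g) A + emeasure (density (interval_measure m) e) A"
      using A g(1) e(1) by (simp add: emeasure_density distrib_right nn_integral_add)
    also have "\<dots> = emeasure (interval_measure h) A"
      unfolding g e by (rule interval_measure_add[symmetric, OF f d h]) (use A in auto)
    finally show "emeasure (density (interval_measure m) (\<lambda>x. g x + e x)) A =
      emeasure (interval_measure h) A" .
  qed simp
  then have "AE x in interval_measure m. g x + e x = k x"
    using g(1) e(1) k by (intro M.density_unique) auto
  then show ?thesis by (rule AE_mp) (intro AE_I2 impI, metis le_iff_add)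
qed

section \<open>Distribution functions from 2-increasing functions\<close>

text \<open>
  This is the existence half of the Lebesgue--Stieltjes correspondence in the plane.  The measure is
  built as the law of a pair \<open>(x, Y)\<close>, where \<open>x\<close> follows the first marginal \<open>m\<close> and \<open>Y\<close> is
  obtained from \<open>x\<close> and a second, Lebesgue distributed coordinate by inverting the conditional
  distribution function \<open>k y x\<close>.  The latter is a regularised Radon--Nikodym derivative of the measure of
  \<open>F (\<cdot>, y)\<close> with respect to that of \<open>m\<close>; 2-increasingness is what makes the former measure
  dominated by the latter, and makes the densities increase with \<open>y\<close>.
\<close>

theorem bivariate_df_of_2_increasing:
  fixes F :: "real \<times> real \<Rightarrow> real"
  assumes incr: "\<And>a b c d. a \<le> b \<Longrightarrow> c \<le> d \<Longrightarrow> F (b, c) + F (a, d) \<le> F (a, c) + F (b, d)"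
    and rc1: "\<And>x y. continuous (at_right x) (\<lambda>x. F (x, y))"
    and rc2: "\<And>x y. continuous (at_right y) (\<lambda>y. F (x, y))"
    and bot1: "\<And>y. ((\<lambda>x. F (x, y)) \<longlongrightarrow> 0) at_bot"
    and bot2: "\<And>x. ((\<lambda>y. F (x, y)) \<longlongrightarrow> 0) at_bot"
    and top: "(\<lambda>n. F (real n, real n)) \<longlonglongrightarrow> 1"
  shows "bivariate_df F"
proof -
  have mono1: "F (a, y) \<le> F (b, y)" if "a \<le> b" for a b y
  proof -
    have "((\<lambda>c. F (b, c) + F (a, y)) \<longlongrightarrow> 0 + F (a, y)) at_bot"
      by (intro tendsto_intros bot2)
    moreover have "((\<lambda>c. F (a, c) + F (b, y)) \<longlongrightarrow> 0 + F (b, y)) at_bot"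
      by (intro tendsto_intros bot2)
    moreover have "eventually (\<lambda>c. F (b, c) + F (a, y) \<le> F (a, c) + F (b, y)) at_bot"
      using incr[OF that] by (auto simp: eventually_at_bot_linorder)
    ultimately have "0 + F (a, y) \<le> 0 + F (b, y)"
      by (intro tendsto_le[OF trivial_limit_at_bot_linorder])
    then show ?thesis by simp
  qed
  have mono2: "F (x, c) \<le> F (x, d)" if "c \<le> d" for c d x
  proof -
    have "((\<lambda>a. F (x, c) + F (a, d)) \<longlongrightarrow> F (x, c) + 0) at_bot"
      by (intro tendsto_intros bot1)
    moreover have "((\<lambda>a. F (a, c) + F (x, d)) \<longlongrightarrow> 0 + F (x, d)) at_bot"
      by (intro tendsto_intros bot1)
    moreover have "eventually (\<lambda>a. F (x, c) + F (a, d) \<le> F (a, c) + F (x, d)) at_bot"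
      using incr[OF _ that] by (auto simp: eventually_at_bot_linorder)
    ultimately have "F (x, c) + 0 \<le> 0 + F (x, d)"
      by (intro tendsto_le[OF trivial_limit_at_bot_linorder])
    then show ?thesis by simp
  qed
  have nonneg: "0 \<le> F (x, y)" for x y
    by (rule tendsto_upperbound[OF bot1[of y]])
       (auto simp: eventually_at_bot_linorder intro!: exI[of _ x] mono1)
  have le_1: "F (x, y) \<le> 1" for x y
  proof (rule LIMSEQ_le_const[OF top])
    obtain N where N: "max x y \<le> real N" using real_arch_simple by blast
    have "F (x, y) \<le> F (real n, real n)" if "N \<le> n" for n
      using mono1[of x "real n" y] mono2[of y "real n" "real n"] N that by force
    then show "\<exists>N. \<forall>n\<ge>N. F (x, y) \<le> F (real n, real n)" by blast
  qed

  (* The first marginal.  Its distance to F(., y) increases along the line, hence F(., y) tends to m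
     uniformly on left half-lines; right continuity and the limit at minus infinity pass to m. *)
  define m where "m x = (SUP n. F (x, real n))" for x
  have m_seq: "(\<lambda>n. F (x, real n)) \<longlonglongrightarrow> m x" for x
    unfolding m_def
    by (rule LIMSEQ_incseq_SUP) (auto simp: incseq_def intro!: mono2 bdd_aboveI[of _ 1] le_1)
  have m_upper: "F (x, y) \<le> m x" for x y
  proof -
    obtain n where "y \<le> real n" using real_arch_simple by blast
    then have "F (x, y) \<le> F (x, real n)" by (rule mono2)
    also have "\<dots> \<le> m x"
      unfolding m_def by (rule cSUP_upper) (auto intro!: bdd_aboveI[of _ 1] le_1)
    finally show ?thesis .
  qed
  have m_le_1: "m x \<le> 1" for x
    by (rule LIMSEQ_le_const2[OF m_seq]) (auto simp: le_1)
  have m_diff: "F (b, y) + m a \<le> F (a, y) + m b" if "a \<le> b" for a b y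
  proof (rule tendsto_le)
    show "(\<lambda>n. F (b, y) + F (a, real n)) \<longlonglongrightarrow> F (b, y) + m a"
      "(\<lambda>n. F (a, y) + F (b, real n)) \<longlonglongrightarrow> F (a, y) + m b"
      by (intro tendsto_intros m_seq)+
    obtain N where "y \<le> real N" using real_arch_simple by blast
    then show "eventually (\<lambda>n. F (b, y) + F (a, real n) \<le> F (a, y) + F (b, real n)) sequentially"
      using incr[OF that] by (intro eventually_sequentiallyI[of N]) auto
  qed simp
  have m_mono: "m a \<le> m b" if "a \<le> b" for a b
    using m_diff[OF that] mono1[OF that] by (smt (verit))
  have m_approx: "\<exists>y. \<forall>x\<le>b. F (x, y) \<le> m x \<and> m x < F (x, y) + e" if "0 < e" for b e
  proof -
    have "eventually (\<lambda>n. m b - e < F (b, real n)) sequentially"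
      using order_tendstoD(1)[OF m_seq[of b], of "m b - e"] that by simp
    then obtain n where "m b < F (b, real n) + e"
      by (auto simp: eventually_sequentially algebra_simps)
    then show ?thesis
      using m_diff[of _ b "real n"] m_upper by (intro exI[of _ "real n"]) (smt (verit))
  qed
  have m_rc: "continuous (at_right x) m" for x
    unfolding continuous_within
  proof (rule tendstoI)
    fix e :: real assume "0 < e"
    obtain y where y: "\<And>z. z \<le> x + 1 \<Longrightarrow> F (z, y) \<le> m z \<and> m z < F (z, y) + e / 2"
      using m_approx[of "e / 2" "x + 1"] \<open>0 < e\<close> by auto
    have "eventually (\<lambda>z. dist (F (z, y)) (F (x, y)) < e / 2) (at_right x)"
      using rc1[of x y] \<open>0 < e\<close> unfolding continuous_within by (intro tendstoD) auto
    moreover have "eventually (\<lambda>z. z \<in> {x<..x + 1}) (at_right x)"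
      by (auto simp: eventually_at_right_field intro!: exI[of _ "x + 1"])
    ultimately show "eventually (\<lambda>z. dist (m z) (m x) < e) (at_right x)"
    proof eventually_elim
      case (elim z)
      then show ?case using y[of z] y[of x] m_mono[of x z] mono1[of x z y]
        by (auto simp: dist_real_def)
    qed
  qed
  have m_bot: "(m \<longlongrightarrow> 0) at_bot"
  proof (rule tendstoI)
    fix e :: real assume "0 < e"
    obtain y where y: "\<And>z. z \<le> 0 \<Longrightarrow> F (z, y) \<le> m z \<and> m z < F (z, y) + e / 2"
      using m_approx[of "e / 2" 0] \<open>0 < e\<close> by auto
    have "eventually (\<lambda>z. dist (F (z, y)) 0 < e / 2) at_bot"
      using bot1[of y] \<open>0 < e\<close> by (intro tendstoD) auto
    moreover have "eventually (\<lambda>z::real. z \<le> 0) at_bot" by (rule eventually_le_at_bot)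
    ultimately show "eventually (\<lambda>z. dist (m z) 0 < e) at_bot"
    proof eventually_elim
      case (elim z)
      then show ?case using y[of z] nonneg[of z y] by (auto simp: dist_real_def)
    qed
  qed

  have finite_measure_dfI: "finite_measure_df f"
    if "\<And>a b. a \<le> b \<Longrightarrow> f a \<le> f b" "\<And>x. continuous (at_right x) f" "(f \<longlongrightarrow> 0) at_bot"
      "\<And>x. f x \<le> 1" for f
  proof -
    have "(\<lambda>n. f (real n)) \<longlonglongrightarrow> (SUP n. f (real n))"
      by (rule LIMSEQ_incseq_SUP) (auto simp: incseq_def intro!: that bdd_aboveI[of _ 1])
    then have "(f \<longlongrightarrow> (SUP n. f (real n))) at_top"
      by (intro tendsto_at_topI_sequentially_real) (auto simp: mono_def that)
    then show ?thesis using that by (auto simp: finite_measure_df_def mono_def)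
  qed
  have df_m: "finite_measure_df m"
    by (rule finite_measure_dfI) (use m_mono m_rc m_bot m_le_1 in auto)
  have df_F: "finite_measure_df (\<lambda>x. F (x, y))" for y
    by (rule finite_measure_dfI) (use mono1 rc1 bot1 le_1 in auto)
  have df_m_diff: "finite_measure_df (\<lambda>x. m x - F (x, y))" for y
  proof (rule finite_measure_dfI)
    show "m x - F (x, y) \<le> 1" for x using m_le_1[of x] nonneg[of x y] by simp
    show "((\<lambda>x. m x - F (x, y)) \<longlongrightarrow> 0) at_bot"
      using tendsto_diff[OF m_bot bot1[of y]] by simp
  qed (use m_diff m_rc rc1 in \<open>auto intro!: continuous_intros simp: algebra_simps\<close>)
  have df_F_diff: "finite_measure_df (\<lambda>x. F (x, r) - F (x, y))" if "y \<le> r" for y r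
  proof (rule finite_measure_dfI)
    show "F (x, r) - F (x, y) \<le> 1" for x using le_1[of x r] nonneg[of x y] by simp
    show "((\<lambda>x. F (x, r) - F (x, y)) \<longlongrightarrow> 0) at_bot"
      using tendsto_diff[OF bot1[of r] bot1[of y]] by simp
  qed (use incr[OF _ that] rc1 in \<open>auto intro!: continuous_intros simp: algebra_simps\<close>)
  have df_m_F_diff: "finite_measure_df (\<lambda>x. m x - (F (x, r) - F (x, y)))" if "y \<le> r" for y r
  proof (rule finite_measure_dfI)
    show "m x - (F (x, r) - F (x, y)) \<le> 1" for x using m_le_1[of x] mono2[OF that, of x] by simp
    show "((\<lambda>x. m x - (F (x, r) - F (x, y))) \<longlongrightarrow> 0) at_bot"
      using tendsto_diff[OF m_bot tendsto_diff[OF bot1[of r] bot1[of y]]] by simp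
    show "m a - (F (a, r) - F (a, y)) \<le> m b - (F (b, r) - F (b, y))" if "a \<le> b" for a b
      using m_diff[OF that, of r] mono1[OF that, of y] by simp
  qed (use m_rc rc1 in \<open>auto intro!: continuous_intros\<close>)

  let ?\<mu> = "interval_measure m"
  interpret \<mu>: finite_borel_measure ?\<mu>
    by (rule finite_borel_interval_measure_finite_measure_df[OF df_m])
  have "\<exists>g. g \<in> borel_measurable borel \<and> density ?\<mu> g = interval_measure (\<lambda>x. F (x, y))" for y
    using density_of_dominated_finite_measure_df[OF df_F df_m df_m_diff] by metis
  then obtain g where g [measurable]: "\<And>y. g y \<in> borel_measurable borel"
    and dens: "\<And>y. density ?\<mu> (g y) = interval_measure (\<lambda>x. F (x, y))"
    by metis
  (* The densities g y are determined only up to null sets depending on y.  The infimum over the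
     rationals above y is monotone and right continuous in y at every single point x, and it is still
     a density of F(., y). *)
  define k where "k y x = (INF r\<in>{r\<in>\<rat>. y < r}. g r x)" for y x
  have k_meas [measurable]: "k y \<in> borel_measurable borel" for y
    unfolding k_def
    by (intro borel_measurable_INF) (auto intro: countable_subset[OF _ countable_rat])
  have k_mono: "k y x \<le> k z x" if "y \<le> z" for x y z
    unfolding k_def using that by (intro INF_superset_mono) auto
  have k_rc: "u \<le> k y x" if "\<And>z. y < z \<Longrightarrow> u \<le> k z x" for u y x
    unfolding k_def
  proof (rule INF_greatest)
    fix r assume r: "r \<in> {r\<in>\<rat>. y < r}"
    then obtain z where "y < z" "z < r" using dense by blast
    then show "u \<le> g r x"
      using that[of z] r unfolding k_def by (auto simp: le_INF_iff)
  qed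
  have k_int: "(\<integral>\<^sup>+x\<in>{..a}. k y x \<partial>?\<mu>) = F (a, y)" for a y
  proof (rule antisym)
    have g_int: "(\<integral>\<^sup>+x\<in>{..a}. g y x \<partial>?\<mu>) = F (a, y)" for y
    proof -
      have "emeasure (density ?\<mu> (g y)) {..a} = F (a, y)"
        unfolding dens by (rule emeasure_interval_measure_finite_measure_df_Iic[OF df_F])
      then show ?thesis by (simp add: emeasure_density)
    qed
    have "AE x in ?\<mu>. \<forall>r\<in>{r\<in>\<rat>. y < r}. g y x \<le> g r x"
    proof (subst AE_ball_countable, (auto intro: countable_subset[OF _ countable_rat])[1], rule ballI)
      fix r assume "r \<in> {r\<in>\<rat>. y < r}"
      then have "y \<le> r" by auto
      show "AE x in ?\<mu>. g y x \<le> g r x"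
        by (rule density_mono_finite_measure_df[OF df_m df_F df_F df_F_diff[OF \<open>y \<le> r\<close>] df_m_diff
              df_m_F_diff[OF \<open>y \<le> r\<close>] g dens g dens])
    qed
    then have "AE x in ?\<mu>. g y x \<le> k y x"
      by (rule AE_mp) (auto simp: k_def intro!: AE_I2 INF_greatest)
    then have "(\<integral>\<^sup>+x\<in>{..a}. g y x \<partial>?\<mu>) \<le> (\<integral>\<^sup>+x\<in>{..a}. k y x \<partial>?\<mu>)"
      by (intro nn_integral_mono_AE) (auto intro!: mult_right_mono)
    then show "F (a, y) \<le> (\<integral>\<^sup>+x\<in>{..a}. k y x \<partial>?\<mu>)" by (simp add: g_int)
    have le: "(\<integral>\<^sup>+x\<in>{..a}. k y x \<partial>?\<mu>) \<le> F (a, z)" if "y < z" for z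
    proof -
      obtain r where r: "r \<in> \<rat>" "y < r" "r < z" using Rats_dense_in_real[OF \<open>y < z\<close>] by blast
      have "(\<integral>\<^sup>+x\<in>{..a}. k y x \<partial>?\<mu>) \<le> (\<integral>\<^sup>+x\<in>{..a}. g r x \<partial>?\<mu>)"
        using r by (intro nn_integral_mono mult_right_mono) (auto simp: k_def intro!: INF_lower)
      also have "\<dots> \<le> F (a, z)" unfolding g_int using mono2[of r z a] r by (auto intro: ennreal_leI)
      finally show ?thesis .
    qed
    have "((\<lambda>z. ennreal (F (a, z))) \<longlongrightarrow> ennreal (F (a, y))) (at_right y)"
      using rc2[of y a] unfolding continuous_within by (rule tendsto_ennrealI)
    then show "(\<integral>\<^sup>+x\<in>{..a}. k y x \<partial>?\<mu>) \<le> F (a, y)"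
      by (rule tendsto_lowerbound)
         (use le in \<open>auto simp: eventually_at_right_field intro!: exI[of _ "y + 1"]\<close>)
  qed

  (* E y is the region under the graph of k y.  Lebesgue measure on the whole line serves as the law
     of the second coordinate, as only the part under the graphs is kept in the end. *)
  define P where "P = ?\<mu> \<Otimes>\<^sub>M (lborel :: real measure)"
  have sets_P [measurable_cong, simp]: "sets P = sets (borel \<Otimes>\<^sub>M borel)"
    unfolding P_def by (intro sets_pair_measure_cong) auto
  have space_P [simp]: "space P = UNIV" by (simp add: P_def space_pair_measure)
  define E where "E y = {w. 0 < snd w \<and> ennreal (snd w) \<le> k y (fst w)}" for y
  have E_meas [measurable]: "E y \<in> sets P" for y
  proof -
    have "{w \<in> space (borel \<Otimes>\<^sub>M borel). 0 < snd w \<and> ennreal (snd w) \<le> k y (fst w)} \<in> sets (borel \<Otimes>\<^sub>M borel)"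
      by measurable
    then show ?thesis by (simp add: E_def space_pair_measure)
  qed
  have E_prob: "emeasure P (({..a} \<times> UNIV) \<inter> E y) = F (a, y)" for a y
  proof -
    have "emeasure P (({..a} \<times> UNIV) \<inter> E y) =
      (\<integral>\<^sup>+x. emeasure lborel (Pair x -` (({..a} \<times> UNIV) \<inter> E y)) \<partial>?\<mu>)"
      unfolding P_def
      by (rule lborel.emeasure_pair_measure_alt) (use E_meas[of y] in \<open>auto simp: P_def[symmetric]\<close>)
    also have "\<dots> = (\<integral>\<^sup>+x\<in>{..a}. k y x \<partial>?\<mu>)"
    proof (rule nn_integral_cong_AE)
      have "AE x in ?\<mu>. k y x * indicator {..a} x \<noteq> \<infinity>"
        by (rule nn_integral_PInf_AE) (auto simp: k_int)
      then show "AE x in ?\<mu>. emeasure lborel (Pair x -` (({..a} \<times> UNIV) \<inter> E y)) =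
        k y x * indicator {..a} x"
      proof (rule AE_mp, intro AE_I2 impI)
        fix x assume fin: "k y x * indicator {..a} x \<noteq> \<infinity>"
        show "emeasure lborel (Pair x -` (({..a} \<times> UNIV) \<inter> E y)) = k y x * indicator {..a} x"
        proof (cases "x \<le> a")
          case True
          then obtain c where c: "0 \<le> c" "k y x = ennreal c"
            using fin by (cases "k y x") auto
          then have "Pair x -` (({..a} \<times> UNIV) \<inter> E y) = {0<..c}"
            using True by (auto simp: E_def)
          then show ?thesis using c True by simp
        qed (simp add: indicator_def)
      qed
    qed
    finally show ?thesis by (simp add: k_int)
  qed
  have E_mono: "E y \<subseteq> E z" if "y \<le> z" for y z
    unfolding E_def using order_trans[OF _ k_mono[OF that]] by blast

  (* On \<Omega> the set of all y with w in E y is neither empty nor the whole line, so that its infimum Y w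
     is a real number, and it is attained by right continuity of k. *)
  define \<Omega> where "\<Omega> = (\<Union>n. E (real n)) - (\<Inter>n. E (- real n))"
  have \<Omega>_meas [measurable]: "\<Omega> \<in> sets P" unfolding \<Omega>_def by measurable
  define Y where "Y w = (if w \<in> \<Omega> then Inf {y. w \<in> E y} else 0)" for w
  have Y_le: "Y w \<le> y \<longleftrightarrow> w \<in> E y" if w: "w \<in> \<Omega>" for w y
  proof -
    obtain n n' where n: "w \<in> E (real n)" "w \<notin> E (- real n')" using w by (auto simp: \<Omega>_def)
    have bdd: "bdd_below {y. w \<in> E y}"
      by (rule bdd_belowI[of _ "- real n'"]) (use n E_mono in \<open>metis linear mem_Collect_eq subsetD\<close>)
    have ne: "{y. w \<in> E y} \<noteq> {}" using n by auto
    show ?thesis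
    proof
      assume "w \<in> E y"
      then show "Y w \<le> y" using bdd w by (auto simp: Y_def intro: cInf_lower)
    next
      assume "Y w \<le> y"
      then have le: "Inf {y. w \<in> E y} \<le> y" using w by (simp add: Y_def)
      have in_E: "w \<in> E z" if z: "y < z" for z
      proof -
        obtain v where "w \<in> E v" "v < z"
          using cInf_lessD[OF ne, of z] le z by force
        then show ?thesis using E_mono[of v z] by auto
      qed
      show "w \<in> E y"
        using in_E[of "y + 1"] k_rc[of y "ennreal (snd w)" "fst w"] in_E
        by (auto simp: E_def)
    qed
  qed
  have Y_meas [measurable]: "Y \<in> borel_measurable P"
  proof (subst borel_measurable_iff_le, rule allI)
    fix y
    have "{w \<in> space P. Y w \<le> y} = (\<Omega> \<inter> E y) \<union> (if 0 \<le> y then space P - \<Omega> else {})"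
      using Y_le by (auto simp: Y_def)
    also have "\<dots> \<in> sets P"
      using sets.compl_sets[OF \<Omega>_meas] sets.Int[OF \<Omega>_meas E_meas[of y]]
      by (intro sets.Un) (simp_all del: sets_P space_P)
    finally show "{w \<in> space P. Y w \<le> y} \<in> sets P" .
  qed
  define M where "M = distr (density P (indicator \<Omega>)) borel (\<lambda>w. (fst w, Y w))"
  have meas: "(\<lambda>w. (fst w, Y w)) \<in> density P (indicator \<Omega>) \<rightarrow>\<^sub>M borel"
    unfolding borel_prod[symmetric] by measurable
  have M_eq: "emeasure M ({..x} \<times> {..y}) = F (x, y)" for x y
  proof -
    define A where "A = ({..x} \<times> UNIV) \<inter> E y"
    have A_meas [measurable]: "({..x} \<times> UNIV) \<inter> E z \<in> sets P" for z
      by (intro sets.Int E_meas) (simp add: pair_measureI)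
    have "emeasure M ({..x} \<times> {..y}) =
      emeasure (density P (indicator \<Omega>)) ((\<lambda>w. (fst w, Y w)) -` ({..x} \<times> {..y}))"
      unfolding M_def using meas
      by (subst emeasure_distr) (auto intro!: borel_closed closed_Times)
    also have "\<dots> = emeasure P (\<Omega> \<inter> ((\<lambda>w. (fst w, Y w)) -` ({..x} \<times> {..y})))"
    proof -
      have "(\<lambda>w. (fst w, Y w)) -` ({..x} \<times> {..y}) \<in> sets P"
        using measurable_sets[OF meas, of "{..x} \<times> {..y}"]
        by (auto intro!: borel_closed closed_Times)
      with sets.Int[OF \<Omega>_meas this] \<Omega>_meas show ?thesis
        by (subst emeasure_density) (auto simp: indicator_inter_arith[symmetric])
    qed
    also have "\<Omega> \<inter> ((\<lambda>w. (fst w, Y w)) -` ({..x} \<times> {..y})) = \<Omega> \<inter> A"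
      using Y_le by (auto simp: A_def)
    also have "emeasure P (\<Omega> \<inter> A) = emeasure P A"
    proof (rule emeasure_eq_AE)
      let ?N = "\<Inter>n. (({..x} \<times> UNIV) \<inter> E (- real n))"
      have "emeasure P ?N \<le> ennreal (F (x, - real n))" for n
        unfolding E_prob[symmetric] by (intro emeasure_mono A_meas INT_lower UNIV_I)
      moreover have "(\<lambda>n. ennreal (F (x, - real n))) \<longlonglongrightarrow> ennreal 0"
        by (intro tendsto_ennrealI filterlim_compose[OF bot2]
              filterlim_compose[OF filterlim_uminus_at_bot_at_top filterlim_real_sequentially])
      ultimately have "emeasure P ?N \<le> ennreal 0"
        by (intro LIMSEQ_le_const) auto
      moreover have "?N \<in> sets P" by (intro sets.countable_INT image_subsetI A_meas) simp
      ultimately have "AE w in P. w \<notin> ?N"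
        by (intro AE_not_in null_setsI) auto
      then show "AE w in P. w \<in> \<Omega> \<inter> A \<longleftrightarrow> w \<in> A"
      proof (rule AE_mp, intro AE_I2 impI)
        fix w assume "w \<notin> ?N"
        moreover obtain n where "y \<le> real n" using real_arch_simple by blast
        ultimately show "w \<in> \<Omega> \<inter> A \<longleftrightarrow> w \<in> A"
          using E_mono[OF \<open>y \<le> real n\<close>] unfolding \<Omega>_def A_def by blast
      qed
    qed (auto simp: A_def simp del: sets_P intro!: A_meas sets.Int[OF \<Omega>_meas])
    also have "emeasure P A = F (x, y)" unfolding A_def by (rule E_prob)
    finally show ?thesis .
  qed
  have sM: "sets M = sets borel" by (simp add: M_def)
  have "(\<lambda>n. emeasure M ({..real n} \<times> {..real n})) \<longlonglongrightarrow> emeasure M (\<Union>n. {..real n} \<times> {..real n})"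
    by (rule Lim_emeasure_incseq)
       (auto simp: sM incseq_def intro!: borel_closed closed_Times)
  moreover have "(\<lambda>n. emeasure M ({..real n} \<times> {..real n})) \<longlonglongrightarrow> ennreal 1"
    unfolding M_eq by (intro tendsto_ennrealI top)
  moreover have "(\<Union>n. {..real n} \<times> {..real n}) = (UNIV :: (real \<times> real) set)"
  proof (auto)
    fix a b
    obtain n where "max a b \<le> real n" using real_arch_simple by blast
    then show "\<exists>n. a \<le> real n \<and> b \<le> real n" by auto
  qed
  ultimately have "emeasure M UNIV = 1"
    using LIMSEQ_unique by fastforce
  then have "prob_space M"
    using sets_eq_imp_space_eq[OF sM] by (intro prob_spaceI) simp
  moreover have "F = bcdf M"
    by (auto simp: fun_eq_iff bcdf_def measure_def M_eq nonneg)
  ultimately show ?thesis using sM unfolding bivariate_df_def by blast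
qed

section \<open>Properties of bivariate distribution functions and their marginals\<close>

text \<open>
  Exchanging the coordinates turns statements about the first marginal into statements about the
  second.
\<close>

lemma bivariate_df_swap:
  assumes "bivariate_df F"
  shows "bivariate_df (\<lambda>x. F (snd x, fst x))"
proof -
  obtain M where M: "prob_space M" "sets M = sets borel" "F = bcdf M"
    using assms by (auto simp: bivariate_df_def)
  interpret prob_space M by fact
  have sp: "space M = UNIV" using sets_eq_imp_space_eq[OF M(2)] by simp
  define N where "N = distr M borel prod.swap"
  have m: "prod.swap \<in> M \<rightarrow>\<^sub>M borel"
    by (subst measurable_cong_sets[OF M(2) refl])
       (auto intro!: borel_measurable_continuous_onI continuous_on_swap)
  have "(\<lambda>x. F (snd x, fst x)) = bcdf N"
  proof
    fix x :: "real \<times> real"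
    have "prod.swap -` ({..fst x} \<times> {..snd x}) = {..snd x} \<times> {..fst x}" by auto
    then show "F (snd x, fst x) = bcdf N x"
      using m by (simp add: M(3) bcdf_def N_def measure_distr sp borel_closed closed_Times)
  qed
  moreover have "prob_space N" unfolding N_def by (rule prob_space_distr) fact
  ultimately show ?thesis unfolding bivariate_df_def by (auto simp: N_def)
qed

lemma marginal2_eq_marginal1_swap: "marginal2 F = marginal1 (\<lambda>x. F (snd x, fst x))"
  by (simp add: fun_eq_iff marginal1_def marginal2_def)

lemma bivariate_df_nonneg: "bivariate_df F \<Longrightarrow> 0 \<le> F x"
  by (auto simp: bivariate_df_def bcdf_def)

lemma bivariate_df_mono:
  assumes "bivariate_df F" "fst x \<le> fst y" "snd x \<le> snd y"
  shows "F x \<le> F y"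
proof -
  obtain M where M: "prob_space M" "sets M = sets borel" "F = bcdf M"
    using assms by (auto simp: bivariate_df_def)
  interpret prob_space M by fact
  show ?thesis
    unfolding M(3) bcdf_def using assms(2,3)
    by (intro finite_measure_mono) (auto simp: M(2) intro!: borel_closed closed_Times)
qed

lemma bivariate_df_2_increasing:
  assumes "bivariate_df F" "a \<le> b" "c \<le> d"
  shows "F (b, c) + F (a, d) \<le> F (a, c) + F (b, d)"
proof -
  obtain M where M: "prob_space M" "sets M = sets borel" "F = bcdf M"
    using assms by (auto simp: bivariate_df_def)
  interpret prob_space M by fact
  have [simp]: "{..x} \<times> {..y} \<in> sets M" for x y
    by (auto simp: M(2) intro!: borel_closed closed_Times)
  have "measure M (({..b} \<times> {..c}) \<union> ({..a} \<times> {..d})) =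
    F (b, c) + F (a, d) - measure M (({..b} \<times> {..c}) \<inter> ({..a} \<times> {..d}))"
    unfolding M(3) bcdf_def by (subst measure_Un3) (auto simp: fmeasurable_eq_sets)
  also have "({..b} \<times> {..c}) \<inter> ({..a} \<times> {..d}) = {..a} \<times> {..c}" using assms by auto
  finally have "F (b, c) + F (a, d) = F (a, c) + measure M (({..b} \<times> {..c}) \<union> ({..a} \<times> {..d}))"
    by (simp add: M(3) bcdf_def)
  also have "measure M (({..b} \<times> {..c}) \<union> ({..a} \<times> {..d})) \<le> F (b, d)"
    unfolding M(3) bcdf_def using assms by (intro finite_measure_mono) auto
  finally show ?thesis by simp
qed

text \<open>
  Joint continuity from above; the marginal and diagonal versions used later are special cases.
\<close>

lemma bivariate_df_decseq:
  assumes "bivariate_df F" "decseq a" "a \<longlonglongrightarrow> x" "decseq b" "b \<longlonglongrightarrow> y"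
  shows "(\<lambda>n. F (a n, b n)) \<longlonglongrightarrow> F (x, y)"
proof -
  obtain M where M: "prob_space M" "sets M = sets borel" "F = bcdf M"
    using assms by (auto simp: bivariate_df_def)
  interpret prob_space M by fact
  have "(\<lambda>n. measure M ({..a n} \<times> {..b n})) \<longlonglongrightarrow> measure M (\<Inter>n. {..a n} \<times> {..b n})"
    using assms(2,4)
    by (intro finite_Lim_measure_decseq)
       (auto simp: M(2) decseq_def intro!: borel_closed closed_Times intro: order_trans)
  also have "(\<Inter>n. {..a n} \<times> {..b n}) = {..x} \<times> {..y}"
    using decseq_ge[OF assms(2,3)] decseq_ge[OF assms(4,5)]
      LIMSEQ_le_const[OF assms(3)] LIMSEQ_le_const[OF assms(5)]
    by (auto intro: order_trans)
  finally show ?thesis by (simp add: M(3) bcdf_def)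
qed

lemma bivariate_df_right_continuous:
  assumes F: "bivariate_df F"
  shows "continuous (at_right x) (\<lambda>x. F (x, y))" "continuous (at_right y) (\<lambda>y. F (x, y))"
  unfolding continuous_within
  by (rule tendsto_at_right_sequentially[where b = "x + 1"], simp,
      rule bivariate_df_decseq[OF F], auto simp: decseq_def)
     (rule tendsto_at_right_sequentially[where b = "y + 1"], simp,
      rule bivariate_df_decseq[OF F], auto simp: decseq_def)

lemma bivariate_df_le_1:
  assumes "bivariate_df F" shows "F x \<le> 1"
  using assms by (auto simp: bivariate_df_def bcdf_def prob_space.prob_le_1)

lemma marginal1_eq_cdf:
  assumes "bivariate_df F"
  obtains N where "real_distribution N" "marginal1 F = cdf N"
proof -
  obtain M where M: "prob_space M" "sets M = sets borel" "F = bcdf M"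
    using assms by (auto simp: bivariate_df_def)
  have "fst \<in> borel_measurable M"
    by (subst measurable_cong_sets[OF M(2) refl])
       (auto intro!: borel_measurable_continuous_onI continuous_on_fst)
  then have "real_distribution (distr M borel fst)"
    using M(1) by (intro prob_space.real_distribution_distr)
  with marginal1_bcdf[OF M(1,2)] show ?thesis
    by (intro that[of "distr M borel fst"]) (auto simp: M(3) fun_eq_iff)
qed

lemma tendsto_marginal1:
  assumes F: "bivariate_df F"
  shows "((\<lambda>y. F (x, y)) \<longlongrightarrow> marginal1 F x) at_top"
proof -
  have "(\<lambda>n. F (x, real n)) \<longlonglongrightarrow> (SUP n. F (x, real n))"
    by (rule LIMSEQ_incseq_SUP)
       (auto simp: incseq_def intro!: bdd_aboveI[of _ 1] bivariate_df_le_1[OF F] bivariate_df_mono[OF F])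
  then have *: "((\<lambda>y. F (x, y)) \<longlongrightarrow> (SUP n. F (x, real n))) at_top"
    by (intro tendsto_at_topI_sequentially_real) (auto simp: mono_def intro: bivariate_df_mono[OF F])
  then show ?thesis unfolding marginal1_def by (simp add: tendsto_Lim[OF _ *])
qed

lemma tendsto_marginal2:
  assumes "bivariate_df F"
  shows "((\<lambda>x. F (x, y)) \<longlongrightarrow> marginal2 F y) at_top"
  using tendsto_marginal1[OF bivariate_df_swap[OF assms]]
  by (simp add: marginal2_eq_marginal1_swap)

lemma
  assumes F: "bivariate_df F"
  shows marginal1_mono: "x \<le> y \<Longrightarrow> marginal1 F x \<le> marginal1 F y"
    and marginal1_nonneg: "0 \<le> marginal1 F x"
    and marginal1_le_1: "marginal1 F x \<le> 1"
    and marginal1_at_top: "(marginal1 F \<longlongrightarrow> 1) at_top"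
    and marginal1_at_bot: "(marginal1 F \<longlongrightarrow> 0) at_bot"
    and marginal1_right_continuous: "continuous (at_right x) (marginal1 F)"
proof -
  obtain N where N: "real_distribution N" and eq: "marginal1 F = cdf N"
    using marginal1_eq_cdf[OF F] .
  interpret real_distribution N by fact
  show "x \<le> y \<Longrightarrow> marginal1 F x \<le> marginal1 F y" "0 \<le> marginal1 F x" "marginal1 F x \<le> 1"
    "(marginal1 F \<longlongrightarrow> 1) at_top" "(marginal1 F \<longlongrightarrow> 0) at_bot"
    "continuous (at_right x) (marginal1 F)"
    unfolding eq using cdf_nondecreasing cdf_nonneg cdf_bounded_prob cdf_lim_at_top_prob
      cdf_lim_at_bot cdf_is_right_cont by auto
qed

lemma
  assumes F: "bivariate_df F"
  shows marginal2_mono: "x \<le> y \<Longrightarrow> marginal2 F x \<le> marginal2 F y"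
    and marginal2_nonneg: "0 \<le> marginal2 F x"
    and marginal2_le_1: "marginal2 F x \<le> 1"
    and marginal2_at_top: "(marginal2 F \<longlongrightarrow> 1) at_top"
    and marginal2_at_bot: "(marginal2 F \<longlongrightarrow> 0) at_bot"
    and marginal2_right_continuous: "continuous (at_right x) (marginal2 F)"
  unfolding marginal2_eq_marginal1_swap
  using bivariate_df_swap[OF F] marginal1_mono marginal1_nonneg marginal1_le_1 marginal1_at_top
    marginal1_at_bot marginal1_right_continuous by blast+

lemma bivariate_df_le_marginal1:
  assumes F: "bivariate_df F" shows "F (x, y) \<le> marginal1 F x"
  by (rule tendsto_lowerbound[OF tendsto_marginal1[OF F, of x]])
     (auto simp: eventually_at_top_linorder intro!: exI[of _ y] bivariate_df_mono[OF F])

lemma bivariate_df_le_marginal2: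
  assumes F: "bivariate_df F" shows "F (x, y) \<le> marginal2 F y"
  using bivariate_df_le_marginal1[OF bivariate_df_swap[OF F], of y x]
  by (simp add: marginal2_eq_marginal1_swap)

lemma bivariate_df_ge_marginals:
  assumes F: "bivariate_df F"
  shows "marginal1 F x + marginal2 F y - 1 \<le> F (x, y)"
proof -
  have le: "F (b, y) + marginal1 F x \<le> F (x, y) + 1" if "x \<le> b" for b
  proof (rule tendsto_upperbound)
    show "((\<lambda>d. F (b, y) + F (x, d)) \<longlongrightarrow> F (b, y) + marginal1 F x) at_top"
      by (intro tendsto_intros tendsto_marginal1 F)
    have "F (b, y) + F (x, d) \<le> F (x, y) + 1" if "y \<le> d" for d
      using bivariate_df_2_increasing[OF F \<open>x \<le> b\<close> that] bivariate_df_le_1[OF F, of "(b, d)"] by simp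
    then show "eventually (\<lambda>d. F (b, y) + F (x, d) \<le> F (x, y) + 1) at_top"
      by (auto simp: eventually_at_top_linorder)
  qed simp
  have "marginal2 F y + marginal1 F x \<le> F (x, y) + 1"
  proof (rule tendsto_upperbound)
    show "((\<lambda>b. F (b, y) + marginal1 F x) \<longlongrightarrow> marginal2 F y + marginal1 F x) at_top"
      by (intro tendsto_intros tendsto_marginal2 F)
    show "eventually (\<lambda>b. F (b, y) + marginal1 F x \<le> F (x, y) + 1) at_top"
      using le by (auto simp: eventually_at_top_linorder)
  qed simp
  then show ?thesis by simp
qed

text \<open>
  For a function that vanishes off a closed quadrant the conditions are needed on the quadrant alone:
  on a rectangle that crosses the boundary, 2-increasingness degenerates to monotonicity.
\<close>

lemma bivariate_df_of_quadrant:
  fixes F :: "real \<times> real \<Rightarrow> real"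
  assumes zero: "\<And>x y. \<not> (l \<le> x \<and> l' \<le> y) \<Longrightarrow> F (x, y) = 0"
    and nonneg: "\<And>x. 0 \<le> F x"
    and mono1: "\<And>a b y. l \<le> a \<Longrightarrow> a \<le> b \<Longrightarrow> l' \<le> y \<Longrightarrow> F (a, y) \<le> F (b, y)"
    and mono2: "\<And>x c d. l \<le> x \<Longrightarrow> l' \<le> c \<Longrightarrow> c \<le> d \<Longrightarrow> F (x, c) \<le> F (x, d)"
    and incr: "\<And>a b c d. l \<le> a \<Longrightarrow> a \<le> b \<Longrightarrow> l' \<le> c \<Longrightarrow> c \<le> d \<Longrightarrow>
      F (b, c) + F (a, d) \<le> F (a, c) + F (b, d)"
    and rc1: "\<And>x y. l \<le> x \<Longrightarrow> l' \<le> y \<Longrightarrow> continuous (at_right x) (\<lambda>x. F (x, y))"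
    and rc2: "\<And>x y. l \<le> x \<Longrightarrow> l' \<le> y \<Longrightarrow> continuous (at_right y) (\<lambda>y. F (x, y))"
    and top: "(\<lambda>n. F (real n, real n)) \<longlonglongrightarrow> 1"
  shows "bivariate_df F"
proof (rule bivariate_df_of_2_increasing)
  have mono1': "F (a, y) \<le> F (b, y)" if "a \<le> b" for a b y
    using mono1[of a b y] zero[of a y] nonneg[of "(b, y)"] that by force
  have mono2': "F (x, c) \<le> F (x, d)" if "c \<le> d" for x c d
    using mono2[of x c d] zero[of x c] nonneg[of "(x, d)"] that by force
  show "F (b, c) + F (a, d) \<le> F (a, c) + F (b, d)" if "a \<le> b" "c \<le> d" for a b c d
  proof (cases "l \<le> a \<and> l' \<le> c")
    case True
    then show ?thesis using incr that by blast
  next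
    case False
    then have "F (a, c) = 0 \<and> F (a, d) = 0 \<or> F (a, c) = 0 \<and> F (b, c) = 0"
      using zero by (meson)
    then show ?thesis using mono1'[OF that(1), of d] mono2'[OF that(2), of b] by auto
  qed
  have const: "continuous (at_right x) g" if "x < z" "\<And>y. x \<le> y \<Longrightarrow> y < z \<Longrightarrow> g y = 0"
    for x z :: real and g :: "real \<Rightarrow> real"
    unfolding continuous_within
    by (rule tendsto_eventually) (use that in \<open>auto simp: eventually_at_right_field\<close>)
  show "continuous (at_right x) (\<lambda>x. F (x, y))" for x y
  proof (cases "l \<le> x \<and> l' \<le> y")
    case False
    then show ?thesis using zero
      by (intro const[of x "if l \<le> x then x + 1 else l"]) (auto split: if_splits)
  qed (use rc1 in auto)
  show "continuous (at_right y) (\<lambda>y. F (x, y))" for x y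
  proof (cases "l \<le> x \<and> l' \<le> y")
    case False
    then show ?thesis using zero
      by (intro const[of y "if l' \<le> y then y + 1 else l'"]) (auto split: if_splits)
  qed (use rc2 in auto)
  show "((\<lambda>x. F (x, y)) \<longlongrightarrow> 0) at_bot" for y
    by (rule tendsto_eventually)
       (use zero in \<open>auto simp: eventually_at_bot_dense intro!: exI[of _ l]\<close>)
  show "((\<lambda>y. F (x, y)) \<longlongrightarrow> 0) at_bot" for x
    by (rule tendsto_eventually)
       (use zero in \<open>auto simp: eventually_at_bot_dense intro!: exI[of _ l']\<close>)
qed fact

section \<open>Bi-free roots and their limit\<close>

text \<open>
  Convolution is linear in \<open>marginal - 1\<close>, up to truncation at zero, and in
  \<open>marginal1 * marginal2 / F - 1\<close>; a power therefore multiplies these quantities by \<open>n\<close>.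
\<close>

lemma bifree_max_power_properties:
  assumes "bifree_max_power R n H" "bivariate_df R"
  shows "marginal1 H x = max (real n * (marginal1 R x - 1) + 1) 0"
    "marginal2 H y = max (real n * (marginal2 R y - 1) + 1) 0"
    "H (x, y) > 0 \<longleftrightarrow> R (x, y) > 0 \<and> marginal1 H x > 0 \<and> marginal2 H y > 0"
    "H (x, y) > 0 \<Longrightarrow> marginal1 H x * marginal2 H y / H (x, y) - 1 =
      real n * (marginal1 R x * marginal2 R y / R (x, y) - 1)"
proof -
  have "(\<forall>x. marginal1 H x = max (real n * (marginal1 R x - 1) + 1) 0) \<and>
    (\<forall>y. marginal2 H y = max (real n * (marginal2 R y - 1) + 1) 0) \<and>
    (\<forall>x y. H (x, y) > 0 \<longleftrightarrow> R (x, y) > 0 \<and> marginal1 H x > 0 \<and> marginal2 H y > 0) \<and>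
    (\<forall>x y. H (x, y) > 0 \<longrightarrow> marginal1 H x * marginal2 H y / H (x, y) - 1 =
      real n * (marginal1 R x * marginal2 R y / R (x, y) - 1))"
    using assms(1)
  proof induction
    case one
    have "R (x, y) > 0 \<longleftrightarrow> R (x, y) > 0 \<and> marginal1 R x > 0 \<and> marginal2 R y > 0" for x y
      using bivariate_df_le_marginal1[OF assms(2), of x y]
        bivariate_df_le_marginal2[OF assms(2), of x y] by auto
    then show ?case
      using assms(2) marginal1_nonneg[OF assms(2)] marginal2_nonneg[OF assms(2)] by simp
  next
    case (Suc n H K)
    note IH = Suc.IH and K = Suc.hyps(2)[unfolded bifree_max_conv_def]
    have m1: "marginal1 K x = max (marginal1 H x + marginal1 R x - 1) 0"
      and m2: "marginal2 K x = max (marginal2 H x + marginal2 R x - 1) 0" for x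
      using K by auto
    have "marginal1 K x = max (real (Suc n) * (marginal1 R x - 1) + 1) 0" for x
      using m1[of x] IH marginal1_le_1[OF assms(2), of x]
      by (auto simp: max_def algebra_simps)
    moreover have "marginal2 K x = max (real (Suc n) * (marginal2 R x - 1) + 1) 0" for x
      using m2[of x] IH marginal2_le_1[OF assms(2), of x]
      by (auto simp: max_def algebra_simps)
    moreover have pos: "K (x, y) > 0 \<longleftrightarrow> R (x, y) > 0 \<and> marginal1 K x > 0 \<and> marginal2 K y > 0"
      for x y
    proof -
      have *: "K (x, y) > 0 \<longleftrightarrow> H (x, y) > 0 \<and> R (x, y) > 0 \<and> marginal1 K x > 0 \<and> marginal2 K y > 0"
        using K by (smt (verit) fst_conv snd_conv)
      have "marginal1 H x > 0" if "marginal1 K x > 0"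
        using that m1[of x] marginal1_le_1[OF assms(2), of x] by (auto simp: max_def split: if_splits)
      moreover have "marginal2 H y > 0" if "marginal2 K y > 0"
        using that m2[of y] marginal2_le_1[OF assms(2), of y] by (auto simp: max_def split: if_splits)
      ultimately show ?thesis using * IH by blast
    qed
    moreover have "marginal1 K x * marginal2 K y / K (x, y) - 1 =
      real (Suc n) * (marginal1 R x * marginal2 R y / R (x, y) - 1)" if "K (x, y) > 0" for x y
    proof -
      have H: "H (x, y) > 0 \<and> R (x, y) > 0 \<and> marginal1 K x > 0 \<and> marginal2 K y > 0"
        using that K by (smt (verit) fst_conv snd_conv)
      then have "marginal1 K x * marginal2 K y / K (x, y) =
        marginal1 H x * marginal2 H y / H (x, y) + marginal1 R x * marginal2 R y / R (x, y) - 1"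
        using K by (metis fst_conv snd_conv)
      moreover have "marginal1 H x * marginal2 H y / H (x, y) - 1 =
        real n * (marginal1 R x * marginal2 R y / R (x, y) - 1)"
        using IH H by blast
      ultimately show ?thesis by (simp add: algebra_simps add_divide_distrib)
    qed
    ultimately show ?case by blast
  qed
  then show "marginal1 H x = max (real n * (marginal1 R x - 1) + 1) 0"
    "marginal2 H y = max (real n * (marginal2 R y - 1) + 1) 0"
    "H (x, y) > 0 \<longleftrightarrow> R (x, y) > 0 \<and> marginal1 H x > 0 \<and> marginal2 H y > 0"
    "H (x, y) > 0 \<Longrightarrow> marginal1 H x * marginal2 H y / H (x, y) - 1 =
      real n * (marginal1 R x * marginal2 R y / R (x, y) - 1)"
    by blast+
qed

lemma bifree_max_infdiv_root:
  assumes F: "bifree_max_infdiv F" and n: "n \<ge> 1"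
  obtains R where "bivariate_df R"
    "\<And>x. marginal1 F x > 0 \<Longrightarrow> marginal1 R x = 1 - (1 - marginal1 F x) / n"
    "\<And>y. marginal2 F y > 0 \<Longrightarrow> marginal2 R y = 1 - (1 - marginal2 F y) / n"
    "\<And>x y. F (x, y) > 0 \<longleftrightarrow> R (x, y) > 0 \<and> marginal1 F x > 0 \<and> marginal2 F y > 0"
    "\<And>x y. F (x, y) > 0 \<Longrightarrow> marginal1 F x * marginal2 F y / F (x, y) - 1 =
      real n * (marginal1 R x * marginal2 R y / R (x, y) - 1)"
proof -
  obtain R where R: "bivariate_df R" "bifree_max_power R n F"
    using F n by (auto simp: bifree_max_infdiv_def)
  note * = bifree_max_power_properties[OF R(2,1)]
  show ?thesis
  proof (rule that[OF R(1)])
    show "marginal1 R x = 1 - (1 - marginal1 F x) / n" if "marginal1 F x > 0" for x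
      using that *(1)[of x] n by (auto simp: field_simps max_def split: if_splits)
    show "marginal2 R x = 1 - (1 - marginal2 F x) / n" if "marginal2 F x > 0" for x
      using that *(2)[of x] n by (auto simp: field_simps max_def split: if_splits)
  qed (use * in blast)+
qed

lemma upward_closed_real_ray:
  fixes S :: "real set"
  assumes "S \<noteq> {}" "S \<noteq> UNIV" and up: "\<And>x y. x \<in> S \<Longrightarrow> x \<le> y \<Longrightarrow> y \<in> S"
  shows "\<exists>l. S = {l<..} \<or> S = {l..}"
proof -
  obtain z where "z \<notin> S" using assms(2) by blast
  then have bdd: "bdd_below S" using up by (intro bdd_belowI[of _ z]) (metis linear)
  have "y \<in> S" if "Inf S < y" for y
    using cInf_lessD[OF assms(1) that] up by (auto intro: less_imp_le)
  moreover have "Inf S \<le> y" if "y \<in> S" for y using that bdd by (rule cInf_lower)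
  ultimately have "S = (if Inf S \<in> S then {Inf S..} else {Inf S<..})"
    by (auto simp: less_le)
  then have "S = {Inf S<..} \<or> S = {Inf S..}" by metis
  then show ?thesis by blast
qed

lemma supp_corner_of_rays:
  assumes "{x. F x > 0} = A \<times> B" "A = {l<..} \<or> A = {l..}" "B = {l'<..} \<or> B = {l'..}"
  shows "supp_corner F (l, l')"
  unfolding supp_corner_def assms(1) using assms(2,3) by auto

text \<open>
  A cube root has marginals above \<open>2/3\<close> where those of \<open>F\<close> are positive.  Two such marginals force
  the root itself to be positive, so the positivity set of \<open>F\<close> is a product; and neither factor is
  the whole line, because the marginals of the root tend to zero at minus infinity.
\<close>

lemma bifree_max_infdiv_supp_corner:
  assumes F: "bifree_max_infdiv F"
  shows "supp_corner F (inf_supp F)"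
proof -
  have df: "bivariate_df F" using F by (simp add: bifree_max_infdiv_def)
  obtain R where R: "bivariate_df R"
    "\<And>x. marginal1 F x > 0 \<Longrightarrow> marginal1 R x = 1 - (1 - marginal1 F x) / real 3"
    "\<And>y. marginal2 F y > 0 \<Longrightarrow> marginal2 R y = 1 - (1 - marginal2 F y) / real 3"
    "\<And>x y. F (x, y) > 0 \<longleftrightarrow> R (x, y) > 0 \<and> marginal1 F x > 0 \<and> marginal2 F y > 0"
    by (rule bifree_max_infdiv_root[OF F, of 3]) auto
  have pos: "F (x, y) > 0 \<longleftrightarrow> marginal1 F x > 0 \<and> marginal2 F y > 0" for x y
  proof -
    have "R (x, y) > 0" if "marginal1 F x > 0" "marginal2 F y > 0"
      using bivariate_df_ge_marginals[OF R(1), of x y] R(2)[OF that(1)] R(3)[OF that(2)] that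
      by (simp add: field_simps)
    then show ?thesis using R(4) by blast
  qed
  have ray: "\<exists>l. {x. 0 < f x} = {l<..} \<or> {x. 0 < f x} = {l..}"
    if "mono f" "(f \<longlongrightarrow> 1) at_top" "(g \<longlongrightarrow> 0) at_bot" "\<And>x. 0 < f x \<Longrightarrow> g x = 1 - (1 - f x) / real 3"
    for f g :: "real \<Rightarrow> real"
  proof (rule upward_closed_real_ray)
    have "eventually (\<lambda>x. 0 < f x) at_top" using order_tendstoD(1)[OF that(2), of 0] by simp
    then show "{x. 0 < f x} \<noteq> {}" by (auto simp: eventually_at_top_linorder)
    have "eventually (\<lambda>x. g x < 1 / 3) at_bot" using order_tendstoD(2)[OF that(3), of "1 / 3"] by simp
    then obtain x where "g x < 1 / 3" by (auto simp: eventually_at_bot_linorder)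
    then have "\<not> 0 < f x" using that(4)[of x] by auto
    then show "{x. 0 < f x} \<noteq> UNIV" by blast
  qed (use that(1) in \<open>auto simp: mono_def intro: less_le_trans\<close>)
  obtain l where l: "{x. 0 < marginal1 F x} = {l<..} \<or> {x. 0 < marginal1 F x} = {l..}"
    using ray[of "marginal1 F" "marginal1 R"] marginal1_mono[OF df] marginal1_at_top[OF df]
      marginal1_at_bot[OF R(1)] R(2) by (auto simp: mono_def)
  obtain l' where l': "{x. 0 < marginal2 F x} = {l'<..} \<or> {x. 0 < marginal2 F x} = {l'..}"
    using ray[of "marginal2 F" "marginal2 R"] marginal2_mono[OF df] marginal2_at_top[OF df]
      marginal2_at_bot[OF R(1)] R(3) by (auto simp: mono_def)
  have "{x. F x > 0} = {x. 0 < marginal1 F x} \<times> {x. 0 < marginal2 F x}"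
    using pos by auto
  from supp_corner_of_rays[OF this l l'] have corner: "supp_corner F (l, l')" .
  show ?thesis
    unfolding inf_supp_def by (rule theI[of "supp_corner F", OF corner supp_corner_unique[OF _ corner]])
qed

text \<open>
  With \<open>R\<close> the \<open>n\<close>-th root, of marginals \<open>p\<close> and \<open>q\<close>, the identities for roots turn \<open>T_pos F\<close> into
  \<open>n * (1 - R) + n * ((p - R) * (q - R) / R)\<close>.  Both \<open>p - R\<close> and \<open>q - R\<close> are at most \<open>1/n\<close> and
  \<open>R\<close> is at least \<open>1 - 2/n\<close>, so the last term vanishes in the limit.  The function \<open>1 - R\<close>, the mass
  off a lower left quadrant, has all the order properties wanted for \<open>T_pos F\<close>.
\<close>

lemma T_pos_limit_of_roots:
  assumes F: "bifree_max_infdiv F"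
  obtains r where "\<And>n. n \<ge> 1 \<Longrightarrow> bivariate_df (r n)"
    "\<And>x. F x > 0 \<Longrightarrow> (\<lambda>n. real n * (1 - r n x)) \<longlonglongrightarrow> T_pos F x"
    "\<And>n x. n \<ge> 1 \<Longrightarrow> F x > 0 \<Longrightarrow> real n * (1 - r n x) \<le> 2 - marginal1 F (fst x) - marginal2 F (snd x)"
proof -
  have df: "bivariate_df F" using F by (simp add: bifree_max_infdiv_def)
  have "\<exists>R. bivariate_df R \<and> (\<forall>x y. F (x, y) > 0 \<longrightarrow>
    marginal1 R x = 1 - (1 - marginal1 F x) / n \<and> marginal2 R y = 1 - (1 - marginal2 F y) / n \<and>
    R (x, y) > 0 \<and> marginal1 F x * marginal2 F y / F (x, y) - 1 =
      real n * (marginal1 R x * marginal2 R y / R (x, y) - 1))" if n: "n \<ge> 1" for n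
  proof -
    obtain R where "bivariate_df R"
      "\<And>x. marginal1 F x > 0 \<Longrightarrow> marginal1 R x = 1 - (1 - marginal1 F x) / n"
      "\<And>y. marginal2 F y > 0 \<Longrightarrow> marginal2 R y = 1 - (1 - marginal2 F y) / n"
      "\<And>x y. F (x, y) > 0 \<longleftrightarrow> R (x, y) > 0 \<and> marginal1 F x > 0 \<and> marginal2 F y > 0"
      "\<And>x y. F (x, y) > 0 \<Longrightarrow> marginal1 F x * marginal2 F y / F (x, y) - 1 =
        real n * (marginal1 R x * marginal2 R y / R (x, y) - 1)"
      by (rule bifree_max_infdiv_root[OF F n]) (rule that)
    then show ?thesis by (intro exI[of _ R]) simp
  qed
  then have "\<forall>n. \<exists>R. n \<ge> 1 \<longrightarrow> bivariate_df R \<and> (\<forall>x y. F (x, y) > 0 \<longrightarrow>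
    marginal1 R x = 1 - (1 - marginal1 F x) / n \<and> marginal2 R y = 1 - (1 - marginal2 F y) / n \<and>
    R (x, y) > 0 \<and> marginal1 F x * marginal2 F y / F (x, y) - 1 =
      real n * (marginal1 R x * marginal2 R y / R (x, y) - 1))" by blast
  from choice[OF this] obtain r where r: "\<And>n. n \<ge> 1 \<Longrightarrow> bivariate_df (r n)"
    "\<And>n x y. n \<ge> 1 \<Longrightarrow> F (x, y) > 0 \<Longrightarrow>
      marginal1 (r n) x = 1 - (1 - marginal1 F x) / n \<and>
      marginal2 (r n) y = 1 - (1 - marginal2 F y) / n \<and> r n (x, y) > 0 \<and>
      marginal1 F x * marginal2 F y / F (x, y) - 1 =
      real n * (marginal1 (r n) x * marginal2 (r n) y / r n (x, y) - 1)"
    by blast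
  show ?thesis
  proof (rule that[of r, OF r(1)])
    show "real n * (1 - r n x) \<le> 2 - marginal1 F (fst x) - marginal2 F (snd x)"
      if n: "n \<ge> 1" and pos: "F x > 0" for n x
    proof -
      have "real n * (1 - r n x) \<le>
        real n * ((1 - marginal1 (r n) (fst x)) + (1 - marginal2 (r n) (snd x)))"
        using bivariate_df_ge_marginals[OF r(1)[OF n], of "fst x" "snd x"]
        by (intro mult_left_mono) auto
      also have "\<dots> = 2 - marginal1 F (fst x) - marginal2 F (snd x)"
        using r(2)[OF n, of "fst x" "snd x"] pos n by (simp add: field_simps)
      finally show ?thesis .
    qed
    show "(\<lambda>n. real n * (1 - r n x)) \<longlonglongrightarrow> T_pos F x" if pos: "F x > 0" for x
    proof -
      obtain a b where x: "x = (a, b)" by fastforce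
      have bound: "0 \<le> T_pos F x - real n * (1 - r n x) \<and>
        T_pos F x - real n * (1 - r n x) \<le> 3 / real n" if n: "n \<ge> 3" for n
      proof -
        define p q s where "p = marginal1 (r n) a" "q = marginal2 (r n) b" "s = r n x"
        have n1: "n \<ge> 1" using n by simp
        note rn = r(2)[OF n1, of a b] and dn = r(1)[OF n1]
        have s: "s > 0" "s \<le> p" "s \<le> q" "p + q - 1 \<le> s"
          using rn pos bivariate_df_le_marginal1[OF dn, of a b] bivariate_df_le_marginal2[OF dn, of a b]
            bivariate_df_ge_marginals[OF dn, of a b] by (auto simp: p_q_s_def x)
        have F1: "marginal1 F a = 1 - real n * (1 - p)" "marginal2 F b = 1 - real n * (1 - q)"
          using rn pos n by (auto simp: p_q_s_def x field_simps)
        have pq: "1 - p \<le> 1 / n" "1 - q \<le> 1 / n"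
          using rn pos n marginal1_nonneg[OF df, of a] marginal2_nonneg[OF df, of b]
          by (auto simp: p_q_s_def x field_simps)
        have "T_pos F x = real n * (p * q / s - 1) + real n * (1 - p) + real n * (1 - q)"
          using rn pos F1 by (simp add: T_pos_def x p_q_s_def)
        then have eq: "T_pos F x - real n * (1 - s) = real n * ((p - s) * (q - s) / s)"
          using s(1) by (simp add: field_simps)
        have "(p - s) * (q - s) \<le> (1 / n) * (1 / n)"
          using s pq by (intro mult_mono) auto
        moreover have "1 - 2 / n \<le> s" using s pq by simp
        ultimately have "(p - s) * (q - s) / s \<le> (1 / n) * (1 / n) / (1 - 2 / n)"
          using n by (intro frac_le) (auto simp: field_simps)
        then have "real n * ((p - s) * (q - s) / s) \<le> real n * ((1 / n) * (1 / n) / (1 - 2 / n))"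
          by (intro mult_left_mono) auto
        also have "\<dots> = 1 / (real n - 2)" using n by (simp add: field_simps)
        also have "\<dots> \<le> 3 / real n" using n by (simp add: field_simps)
        finally have "T_pos F x - real n * (1 - s) \<le> 3 / real n" unfolding eq .
        moreover have "0 \<le> T_pos F x - real n * (1 - s)"
          unfolding eq using s by (intro mult_nonneg_nonneg divide_nonneg_pos) auto
        ultimately show ?thesis by (simp add: p_q_s_def)
      qed
      have "(\<lambda>n. T_pos F x - real n * (1 - r n x)) \<longlonglongrightarrow> 0"
      proof (rule tendsto_sandwich[OF _ _ tendsto_const])
        show "(\<lambda>n. 3 / real n) \<longlonglongrightarrow> 0" by (rule lim_const_over_n)
      qed (use bound in \<open>auto simp: eventually_sequentially\<close>)
      from tendsto_diff[OF tendsto_const[of "T_pos F x"] this] show ?thesis by simp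
    qed
  qed
qed

text \<open>
  All four are closed conditions that hold for \<open>n * (1 - R)\<close> and so pass to the limit.
\<close>

lemma
  assumes F: "bifree_max_infdiv F"
  shows T_pos_antimono: "F x > 0 \<Longrightarrow> fst x \<le> fst y \<Longrightarrow> snd x \<le> snd y \<Longrightarrow> T_pos F y \<le> T_pos F x"
    and T_pos_2_decreasing: "F (a, c) > 0 \<Longrightarrow> a \<le> b \<Longrightarrow> c \<le> d \<Longrightarrow>
      T_pos F (a, c) + T_pos F (b, d) \<le> T_pos F (b, c) + T_pos F (a, d)"
    and T_pos_nonneg: "F x > 0 \<Longrightarrow> 0 \<le> T_pos F x"
    and T_pos_le: "F x > 0 \<Longrightarrow> T_pos F x \<le> 2 - marginal1 F (fst x) - marginal2 F (snd x)"
proof -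
  have df: "bivariate_df F" using F by (simp add: bifree_max_infdiv_def)
  obtain r where r: "\<And>n. n \<ge> 1 \<Longrightarrow> bivariate_df (r n)"
    and lim: "\<And>x. F x > 0 \<Longrightarrow> (\<lambda>n. real n * (1 - r n x)) \<longlonglongrightarrow> T_pos F x"
    and le: "\<And>n x. n \<ge> 1 \<Longrightarrow> F x > 0 \<Longrightarrow>
      real n * (1 - r n x) \<le> 2 - marginal1 F (fst x) - marginal2 F (snd x)"
    by (rule T_pos_limit_of_roots[OF F]) (rule that)
  have up: "F y > 0" if "F x > 0" "fst x \<le> fst y" "snd x \<le> snd y" for x y
    using bivariate_df_mono[OF df that(2,3)] that(1) by simp
  show "T_pos F y \<le> T_pos F x" if x: "F x > 0" "fst x \<le> fst y" "snd x \<le> snd y"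
  proof (rule LIMSEQ_le[OF lim[OF up[OF x]] lim[OF x(1)]], intro exI[of _ 1] allI impI)
    show "real n * (1 - r n y) \<le> real n * (1 - r n x)" if "1 \<le> n" for n
      using bivariate_df_mono[OF r[OF that] x(2,3)] by (intro mult_left_mono) auto
  qed
  show "0 \<le> T_pos F x" if "F x > 0"
  proof (rule LIMSEQ_le_const[OF lim[OF that]], intro exI[of _ 1] allI impI)
    show "0 \<le> real n * (1 - r n x)" if "1 \<le> n" for n
      using bivariate_df_le_1[OF r[OF that], of x] by simp
  qed
  show "T_pos F x \<le> 2 - marginal1 F (fst x) - marginal2 F (snd x)" if "F x > 0"
    by (rule LIMSEQ_le_const2[OF lim[OF that]]) (use le[OF _ that] in blast)
  show "T_pos F (a, c) + T_pos F (b, d) \<le> T_pos F (b, c) + T_pos F (a, d)"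
    if x: "F (a, c) > 0" "a \<le> b" "c \<le> d"
  proof (rule LIMSEQ_le)
    show "(\<lambda>n. real n * (1 - r n (a, c)) + real n * (1 - r n (b, d))) \<longlonglongrightarrow> T_pos F (a, c) + T_pos F (b, d)"
      "(\<lambda>n. real n * (1 - r n (b, c)) + real n * (1 - r n (a, d))) \<longlonglongrightarrow> T_pos F (b, c) + T_pos F (a, d)"
      using x by (intro tendsto_add lim; use up[OF x(1)] in simp)+
    have "real n * (1 - r n (a, c)) + real n * (1 - r n (b, d))
      \<le> real n * (1 - r n (b, c)) + real n * (1 - r n (a, d))" if "n \<ge> 1" for n
      using bivariate_df_2_increasing[OF r[OF that] x(2,3)]
      unfolding distrib_left[symmetric] by (intro mult_left_mono) auto
    then show "\<exists>N. \<forall>n\<ge>N. real n * (1 - r n (a, c)) + real n * (1 - r n (b, d))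
      \<le> real n * (1 - r n (b, c)) + real n * (1 - r n (a, d))" by blast
  qed
qed

section \<open>The exponential of a bi-freely max-infinitely divisible function\<close>

text \<open>
  A point of the closed quadrant \<open>{fst L..} \<times> {snd L..}\<close> may lie outside the positivity set, but the
  points of this sequence, which approach it from the upper right, always lie inside.
\<close>

definition from_above :: "nat \<Rightarrow> real \<times> real \<Rightarrow> real \<times> real" where
  "from_above n x = (fst x + 1 / Suc n, snd x + 1 / Suc n)"

lemma tendsto_plus_inverse_Suc: "(\<lambda>n. c + 1 / real (Suc n)) \<longlonglongrightarrow> c"
  using tendsto_add[OF tendsto_const LIMSEQ_inverse_real_of_nat, of c] by (simp add: inverse_eq_divide)

lemma from_above_simps [simp]:
  "fst (from_above n x) = fst x + 1 / Suc n" "snd (from_above n x) = snd x + 1 / Suc n"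
  by (simp_all add: from_above_def)

lemma tendsto_from_above: "(\<lambda>n. from_above n x) \<longlonglongrightarrow> x"
proof -
  have "(\<lambda>n. from_above n x) \<longlonglongrightarrow> (fst x, snd x)"
    unfolding from_above_def by (intro tendsto_Pair tendsto_plus_inverse_Suc)
  then show ?thesis by simp
qed

lemma tendsto_at_right_continuous_from_above:
  fixes f :: "real \<Rightarrow> real"
  assumes "continuous (at_right x) f"
  shows "(\<lambda>n. f (x + 1 / Suc n)) \<longlonglongrightarrow> f x"
  by (rule continuous_within_tendsto_compose[OF assms _ tendsto_plus_inverse_Suc]) simp

lemma T_pos_from_above:
  assumes F: "bivariate_df F" and pos: "F x > 0"
  shows "(\<lambda>n. T_pos F (from_above n x)) \<longlonglongrightarrow> T_pos F x"
proof -
  have "decseq (\<lambda>n. c + 1 / real (Suc n))" for c :: real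
    by (auto simp: decseq_def intro!: divide_left_mono)
  then have "(\<lambda>n. F (from_above n x)) \<longlonglongrightarrow> F (fst x, snd x)"
    unfolding from_above_def by (intro bivariate_df_decseq[OF F] tendsto_plus_inverse_Suc) auto
  then have "(\<lambda>n. F (from_above n x)) \<longlonglongrightarrow> F x" by simp
  moreover have "(\<lambda>n. marginal1 F (fst (from_above n x))) \<longlonglongrightarrow> marginal1 F (fst x)"
    "(\<lambda>n. marginal2 F (snd (from_above n x))) \<longlonglongrightarrow> marginal2 F (snd x)"
    using tendsto_at_right_continuous_from_above[OF marginal1_right_continuous[OF F]]
      tendsto_at_right_continuous_from_above[OF marginal2_right_continuous[OF F]] by simp_all
  ultimately show ?thesis
    unfolding T_pos_def using pos by (intro tendsto_intros) auto
qed

text \<open>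
  A monotone 2-increasing exponent gives a 2-increasing exponential, by convexity: the case
  \<open>s = q + r - p\<close> is the factorisation \<open>exp p * (exp (q - p) - 1) * (exp (r - p) - 1) \<ge> 0\<close>.
\<close>

lemma exp_2_increasing:
  fixes p q r s :: real
  assumes "p \<le> q" "p \<le> r" "q + r \<le> p + s"
  shows "exp q + exp r \<le> exp p + exp s"
proof -
  have "0 \<le> exp p * ((exp (q - p) - 1) * (exp (r - p) - 1))"
    using assms by (intro mult_nonneg_nonneg) auto
  also have "\<dots> = exp (q + r - p) - exp q - exp r + exp p"
    by (simp add: algebra_simps exp_add exp_diff)
  also have "exp (q + r - p) \<le> exp s" using assms by simp
  finally show ?thesis by simp
qed

locale bifree_max_infdiv_df =
  fixes F :: "real \<times> real \<Rightarrow> real"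
  assumes F: "bifree_max_infdiv F"
begin

abbreviation "L \<equiv> inf_supp F"

lemma df: "bivariate_df F"
  using F by (simp add: bifree_max_infdiv_def)

lemma supp_gt: "fst L < fst x \<Longrightarrow> snd L < snd x \<Longrightarrow> F x > 0"
  using bifree_max_infdiv_supp_corner[OF F] unfolding supp_corner_def by (cases x) (auto simp: set_eq_iff)

lemma supp_from_above: "fst L \<le> fst x \<Longrightarrow> snd L \<le> snd x \<Longrightarrow> F (from_above n x) > 0"
  by (rule supp_gt) (auto intro: le_less_trans)

text \<open>
  The extension of \<open>T_pos F\<close> is described by one sequence, for points inside and outside the
  positivity set alike.  Outside, the limit from above exists because \<open>T_pos F\<close> is bounded and
  antitone: near \<open>x\<close> it is at least \<open>T_pos F (from_above n x)\<close> for any given \<open>n\<close>, and it never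
  exceeds the supremum \<open>S\<close> of these values.
\<close>

lemma T_fun_from_above:
  assumes x: "fst L \<le> fst x" "snd L \<le> snd x"
  shows "(\<lambda>n. T_pos F (from_above n x)) \<longlonglongrightarrow> T_fun F x"
    and "T_pos F (from_above n x) \<le> T_fun F x"
proof -
  define S where "S = (SUP n. T_pos F (from_above n x))"
  have pos: "F (from_above n x) > 0" for n using x by (rule supp_from_above)
  have bdd: "bdd_above (range (\<lambda>n. T_pos F (from_above n x)))"
  proof (rule bdd_aboveI2[of _ _ 2])
    show "T_pos F (from_above n x) \<le> 2" for n
      using T_pos_le[OF F pos[of n]] marginal1_nonneg[OF df] marginal2_nonneg[OF df]
      by (smt (verit))
  qed
  have step: "1 / real (Suc n) \<le> 1 / real (Suc m)" if "m \<le> n" for m n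
    using that by (intro divide_left_mono) auto
  have "incseq (\<lambda>n. T_pos F (from_above n x))"
    unfolding incseq_def using step by (auto intro!: T_pos_antimono[OF F pos])
  with bdd have lim: "(\<lambda>n. T_pos F (from_above n x)) \<longlonglongrightarrow> S"
    unfolding S_def by (rule LIMSEQ_incseq_SUP)
  have le_S: "T_pos F (from_above n x) \<le> S" for n
    unfolding S_def using bdd by (intro cSUP_upper) auto
  have "T_fun F x = S"
  proof (cases "F x > 0")
    case True
    then show ?thesis
      using LIMSEQ_unique[OF T_pos_from_above[OF df True] lim] by (simp add: T_fun_def)
  next
    case False
    let ?A = "{y. F y > 0 \<and> fst x \<le> fst y \<and> snd x \<le> snd y}"
    have "x islimpt ?A"
      unfolding islimpt_sequential
      using pos tendsto_from_above[of x] False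
      by (intro exI[of _ "\<lambda>n. from_above n x"]) (auto simp: from_above_def prod_eq_iff)
    then have nontriv: "at x within ?A \<noteq> bot" by (simp add: trivial_limit_within)
    have upper: "T_pos F y \<le> S" if y: "y \<in> ?A" for y
    proof (rule LIMSEQ_le_const2)
      show "(\<lambda>n. T_pos F (from_above n y)) \<longlonglongrightarrow> T_pos F y"
        using y by (intro T_pos_from_above df) auto
      have "T_pos F (from_above n y) \<le> S" for n
        using T_pos_antimono[OF F pos[of n], of "from_above n y"] le_S[of n] y by auto
      then show "\<exists>N. \<forall>n\<ge>N. T_pos F (from_above n y) \<le> S" by blast
    qed
    have "(T_pos F \<longlongrightarrow> S) (at x within ?A)"
    proof (rule order_tendstoI)
      fix a assume "a < S"
      then obtain n where n: "a < T_pos F (from_above n x)"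
        using order_tendstoD(1)[OF lim] by (auto simp: eventually_sequentially)
      have "a < T_pos F y" if y: "y \<in> ?A" "dist y x < 1 / Suc n" for y
      proof -
        have "dist (fst y) (fst x) < 1 / Suc n" "dist (snd y) (snd x) < 1 / Suc n"
          using y(2) dist_fst_le[of y x] dist_snd_le[of y x] by linarith+
        then have "T_pos F (from_above n x) \<le> T_pos F y"
          using y(1) by (intro T_pos_antimono[OF F]) (auto simp: dist_real_def)
        then show ?thesis using n by simp
      qed
      then show "eventually (\<lambda>y. a < T_pos F y) (at x within ?A)"
        unfolding eventually_at by (intro exI[of _ "1 / Suc n"]) auto
    next
      fix a assume "S < a"
      then show "eventually (\<lambda>y. T_pos F y < a) (at x within ?A)"
        using le_less_trans[OF upper] unfolding eventually_at by (intro exI[of _ 1]) auto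
    qed
    then show ?thesis using False nontriv by (simp add: T_fun_def tendsto_Lim)
  qed
  with lim le_S show "(\<lambda>n. T_pos F (from_above n x)) \<longlonglongrightarrow> T_fun F x"
    "T_pos F (from_above n x) \<le> T_fun F x" by auto
qed

lemma T_fun_antimono:
  assumes "fst L \<le> fst x" "snd L \<le> snd x" "fst x \<le> fst y" "snd x \<le> snd y"
  shows "T_fun F y \<le> T_fun F x"
proof (rule LIMSEQ_le[OF T_fun_from_above(1) T_fun_from_above(1)])
  show "\<exists>N. \<forall>n\<ge>N. T_pos F (from_above n y) \<le> T_pos F (from_above n x)"
    using assms by (auto intro!: T_pos_antimono[OF F] supp_from_above)
qed (use assms in auto)

lemma T_fun_2_decreasing:
  assumes "fst L \<le> a" "snd L \<le> c" "a \<le> b" "c \<le> d"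
  shows "T_fun F (a, c) + T_fun F (b, d) \<le> T_fun F (b, c) + T_fun F (a, d)"
proof (rule LIMSEQ_le[OF tendsto_add tendsto_add])
  show "\<exists>N. \<forall>n\<ge>N. T_pos F (from_above n (a, c)) + T_pos F (from_above n (b, d))
    \<le> T_pos F (from_above n (b, c)) + T_pos F (from_above n (a, d))"
    using assms supp_from_above[of "(a, c)"] unfolding from_above_def
    by (auto intro!: T_pos_2_decreasing[OF F])
qed (rule T_fun_from_above(1); use assms in simp)+

lemma T_fun_nonneg: "fst L \<le> fst x \<Longrightarrow> snd L \<le> snd x \<Longrightarrow> 0 \<le> T_fun F x"
  using T_pos_nonneg[OF F supp_from_above[of x 0]] T_fun_from_above(2)[of x 0] by linarith

text \<open>
  As a supremum of values of \<open>T_pos F\<close> strictly to the upper right of the point, the antitone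
  function \<open>T_fun F\<close> is lower semicontinuous from above.
\<close>

lemma T_fun_right_continuous:
  assumes "fst L \<le> x" "snd L \<le> y"
  shows "continuous (at_right x) (\<lambda>x. T_fun F (x, y))"
    and "continuous (at_right y) (\<lambda>y. T_fun F (x, y))"
proof -
  have lower: "\<exists>e>0. \<forall>z. x \<le> fst z \<and> fst z < x + e \<and> y \<le> snd z \<and> snd z < y + e \<longrightarrow> a < T_fun F z"
    if "a < T_fun F (x, y)" for a
  proof -
    have "eventually (\<lambda>n. a < T_pos F (from_above n (x, y))) sequentially"
      using assms that by (intro order_tendstoD(1)[OF T_fun_from_above(1)]) auto
    then obtain n where n: "a < T_pos F (from_above n (x, y))"
      by (auto simp: eventually_sequentially)
    define d where "d = 1 / real (Suc n)"
    have half: "1 / real (Suc (Suc (2 * n))) = d / 2" by (simp add: d_def field_simps)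
    have "a < T_fun F z"
      if z: "x \<le> fst z" "fst z < x + d / 2" "y \<le> snd z" "snd z < y + d / 2" for z
    proof -
      have "fst (from_above (Suc (2 * n)) z) \<le> fst (from_above n (x, y))"
        "snd (from_above (Suc (2 * n)) z) \<le> snd (from_above n (x, y))"
        unfolding from_above_simps half d_def[symmetric] using z by simp_all
      then have "T_pos F (from_above n (x, y)) \<le> T_pos F (from_above (Suc (2 * n)) z)"
        using z assms by (intro T_pos_antimono[OF F] supp_from_above) auto
      also have "\<dots> \<le> T_fun F z"
        using z assms by (intro T_fun_from_above(2)) auto
      finally show ?thesis using n by simp
    qed
    then show ?thesis by (intro exI[of _ "d / 2"]) (auto simp: d_def)
  qed
  have upper: "T_fun F z \<le> T_fun F (x, y)" if "x \<le> fst z" "y \<le> snd z" for z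
    using assms that by (intro T_fun_antimono) auto
  show "continuous (at_right x) (\<lambda>x. T_fun F (x, y))"
    unfolding continuous_within
  proof (rule order_tendstoI)
    show "eventually (\<lambda>z. a < T_fun F (z, y)) (at_right x)" if a: "a < T_fun F (x, y)" for a
    proof -
      obtain e where "e > 0" and e: "\<And>z. x \<le> fst z \<and> fst z < x + e \<and> y \<le> snd z \<and> snd z < y + e \<Longrightarrow> a < T_fun F z"
        using lower[OF a] by blast
      then show ?thesis
        by (auto simp: eventually_at_right_field intro!: exI[of _ "x + e"])
    qed
    show "eventually (\<lambda>z. T_fun F (z, y) < a) (at_right x)" if a: "T_fun F (x, y) < a" for a
    proof -
      have "T_fun F (z, y) < a" if "x < z" for z
        using upper[of "(z, y)"] a that by simp
      then show ?thesis by (auto simp: eventually_at_right_field intro!: exI[of _ "x + 1"])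
    qed
  qed
  show "continuous (at_right y) (\<lambda>y. T_fun F (x, y))"
    unfolding continuous_within
  proof (rule order_tendstoI)
    show "eventually (\<lambda>z. a < T_fun F (x, z)) (at_right y)" if a: "a < T_fun F (x, y)" for a
    proof -
      obtain e where "e > 0" and e: "\<And>z. x \<le> fst z \<and> fst z < x + e \<and> y \<le> snd z \<and> snd z < y + e \<Longrightarrow> a < T_fun F z"
        using lower[OF a] by blast
      then show ?thesis
        by (auto simp: eventually_at_right_field intro!: exI[of _ "y + e"])
    qed
    show "eventually (\<lambda>z. T_fun F (x, z) < a) (at_right y)" if a: "T_fun F (x, y) < a" for a
    proof -
      have "T_fun F (x, z) < a" if "y < z" for z
        using upper[of "(x, z)"] a that by simp
      then show ?thesis by (auto simp: eventually_at_right_field intro!: exI[of _ "y + 1"])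
    qed
  qed
qed

lemma T_fun_diagonal: "(\<lambda>n. T_fun F (real n, real n)) \<longlonglongrightarrow> 0"
proof (rule tendsto_sandwich[OF _ _ tendsto_const])
  obtain N where "max (fst L) (snd L) < real N" using reals_Archimedean2 by blast
  then have N: "fst L < real n" "snd L < real n" if "N \<le> n" for n using that by auto
  then have pos: "F (real n, real n) > 0" if "N \<le> n" for n
    using that by (intro supp_gt) auto
  show "eventually (\<lambda>n. 0 \<le> T_fun F (real n, real n)) sequentially"
    using N by (intro eventually_sequentiallyI[of N] T_fun_nonneg) (auto intro: less_imp_le)
  show "eventually (\<lambda>n. T_fun F (real n, real n) \<le> 2 - marginal1 F (real n) - marginal2 F (real n)) sequentially"
  proof (rule eventually_sequentiallyI[of N])
    fix n assume "N \<le> n"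
    from T_pos_le[OF F pos[OF this]] pos[OF this]
    show "T_fun F (real n, real n) \<le> 2 - marginal1 F (real n) - marginal2 F (real n)"
      by (simp add: T_fun_def)
  qed
  have "(\<lambda>n. 2 - marginal1 F (real n) - marginal2 F (real n)) \<longlonglongrightarrow> 2 - 1 - 1"
    by (intro tendsto_intros filterlim_compose[OF marginal1_at_top[OF df] filterlim_real_sequentially]
        filterlim_compose[OF marginal2_at_top[OF df] filterlim_real_sequentially])
  then show "(\<lambda>n. 2 - marginal1 F (real n) - marginal2 F (real n)) \<longlonglongrightarrow> 0" by simp
qed

lemma bivariate_df_exp_T:
  assumes t: "t > 0"
  shows "bivariate_df (exp_T t F L)"
proof (rule bivariate_df_of_quadrant[of "fst L" "snd L"])
  have eq: "exp_T t F L (x, y) = exp (- (t * T_fun F (x, y)))" if "fst L \<le> x" "snd L \<le> y" for x y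
    using that by (simp add: exp_T_def)
  note T_fun_mult_left = mult_left_mono[OF T_fun_antimono less_imp_le[OF t]]
  show "exp_T t F L (x, y) = 0" if "\<not> (fst L \<le> x \<and> snd L \<le> y)" for x y
    using that by (auto simp: exp_T_def)
  show "0 \<le> exp_T t F L x" for x by (simp add: exp_T_def)
  show "exp_T t F L (a, y) \<le> exp_T t F L (b, y)" if "fst L \<le> a" "a \<le> b" "snd L \<le> y" for a b y
    using that by (auto simp: eq intro!: T_fun_mult_left)
  show "exp_T t F L (x, c) \<le> exp_T t F L (x, d)" if "fst L \<le> x" "snd L \<le> c" "c \<le> d" for x c d
    using that by (auto simp: eq intro!: T_fun_mult_left)
  show "exp_T t F L (b, c) + exp_T t F L (a, d) \<le> exp_T t F L (a, c) + exp_T t F L (b, d)"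
    if le: "fst L \<le> a" "a \<le> b" "snd L \<le> c" "c \<le> d" for a b c d
  proof -
    have "t * (T_fun F (a, c) + T_fun F (b, d)) \<le> t * (T_fun F (b, c) + T_fun F (a, d))"
      using le t by (intro mult_left_mono T_fun_2_decreasing) auto
    then have "exp (- (t * T_fun F (b, c))) + exp (- (t * T_fun F (a, d)))
      \<le> exp (- (t * T_fun F (a, c))) + exp (- (t * T_fun F (b, d)))"
      using le by (intro exp_2_increasing) (auto intro!: T_fun_mult_left simp: distrib_left)
    then show ?thesis using le by (simp add: eq)
  qed
  show "continuous (at_right x) (\<lambda>x. exp_T t F L (x, y))" if xy: "fst L \<le> x" "snd L \<le> y" for x y
  proof -
    have "((\<lambda>z. exp (- (t * T_fun F (z, y)))) \<longlongrightarrow> exp (- (t * T_fun F (x, y)))) (at_right x)"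
      using T_fun_right_continuous(1)[OF xy] unfolding continuous_within by (intro tendsto_intros)
    moreover have "eventually (\<lambda>z. exp (- (t * T_fun F (z, y))) = exp_T t F L (z, y)) (at_right x)"
      using xy by (auto simp: eventually_at_right_field eq intro!: exI[of _ "x + 1"])
    ultimately show ?thesis
      unfolding continuous_within eq[OF xy] by (rule Lim_transform_eventually)
  qed
  show "continuous (at_right y) (\<lambda>y. exp_T t F L (x, y))" if xy: "fst L \<le> x" "snd L \<le> y" for x y
  proof -
    have "((\<lambda>z. exp (- (t * T_fun F (x, z)))) \<longlongrightarrow> exp (- (t * T_fun F (x, y)))) (at_right y)"
      using T_fun_right_continuous(2)[OF xy] unfolding continuous_within by (intro tendsto_intros)
    moreover have "eventually (\<lambda>z. exp (- (t * T_fun F (x, z))) = exp_T t F L (x, z)) (at_right y)"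
      using xy by (auto simp: eventually_at_right_field eq intro!: exI[of _ "y + 1"])
    ultimately show ?thesis
      unfolding continuous_within eq[OF xy] by (rule Lim_transform_eventually)
  qed
  have "(\<lambda>n. exp (- (t * T_fun F (real n, real n)))) \<longlonglongrightarrow> exp (- (t * 0))"
    by (intro tendsto_intros T_fun_diagonal)
  moreover have "eventually (\<lambda>n. exp (- (t * T_fun F (real n, real n))) = exp_T t F L (real n, real n)) sequentially"
  proof -
    obtain N where "max (fst L) (snd L) \<le> real N" using real_arch_simple by blast
    then show ?thesis by (intro eventually_sequentiallyI[of N]) (auto simp: eq)
  qed
  ultimately show "(\<lambda>n. exp_T t F L (real n, real n)) \<longlonglongrightarrow> 1"
    by (simp add: tendsto_cong)
qed

lemma max_infdiv_exp_T:
  assumes t: "t > 0"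
  shows "max_infdiv (exp_T t F L)"
proof -
  have "(\<lambda>x. exp_T t F L x powr (1 / real n)) = exp_T (t / n) F L" if "n \<ge> 1" for n
    using that by (auto simp: exp_T_def fun_eq_iff powr_def)
  then show ?thesis
    unfolding max_infdiv_def using bivariate_df_exp_T t by simp
qed

end

section \<open>An inequality for bi-free quotients\<close>

lemma bifree_quotient_mono:
  fixes p b b' u v :: real
  assumes "0 \<le> p" "v \<le> u" "u \<le> b" "b < 1" "u - v \<le> b - b'"
  shows "p * (1 - b) / (1 - u) \<le> p * (1 - b') / (1 - v)"
proof -
  have "(1 - b') * (1 - u) - (1 - b) * (1 - v) = (b - b' - (u - v)) * (1 - u) + (u - v) * (b - u)"
    by (simp add: algebra_simps)
  also have "0 \<le> \<dots>" using assms by (intro add_nonneg_nonneg mult_nonneg_nonneg) auto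
  finally have "(1 - b) / (1 - u) \<le> (1 - b') / (1 - v)"
    using assms by (simp add: field_simps)
  from mult_left_mono[OF this assms(1)] show ?thesis by simp
qed

text \<open>
  The functions to be studied have the form \<open>(1 - a) * (1 - b) / (1 - s)\<close>, where \<open>a\<close> and \<open>b\<close> each
  depend on one coordinate.  The digits after \<open>s\<close> tell for each coordinate whether the lower (0)
  or the upper (1) end of a rectangle is taken, and primes mark the upper values of \<open>a\<close> and \<open>b\<close>.
  If some measure gives mass \<open>a\<close>, \<open>b\<close>, \<open>s\<close> to the half-planes and the quadrant to the upper right of a
  point, the hypotheses say that the pieces cut out by the rectangle have nonnegative mass.

  Put \<open>d0 = s00 - s10\<close> and \<open>d1 = s01 - s11\<close>.  From \<open>d1 \<le> d0 \<le> a - a'\<close> the mixed difference is at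
  least \<open>d1\<close> times the change of \<open>(1 - b) / (1 - s1) * ((a - s0) / (1 - s0))\<close> as the second coordinate
  goes from its lower to its upper value, where \<open>s0\<close>, \<open>s1\<close> are the values of \<open>s\<close> at the lower and
  the upper end of the first coordinate.  Both factors increase.
\<close>

lemma bifree_quotient_2_increasing:
  fixes a a' b b' s00 s01 s10 s11 :: real
  assumes a: "a < 1" and b: "b' \<le> b" "b < 1"
    and s: "s00 \<le> a" "s00 \<le> b" "s01 \<le> s00" "s10 \<le> s00" "s11 \<le> s01" "s11 \<le> s10"
    and incr: "s01 + s10 \<le> s00 + s11"
    and da: "s00 - s10 \<le> a - a'" and db: "s10 - s11 \<le> b - b'"
  shows "(1 - a') * (1 - b) / (1 - s10) + (1 - a) * (1 - b') / (1 - s01)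
    \<le> (1 - a) * (1 - b) / (1 - s00) + (1 - a') * (1 - b') / (1 - s11)"
proof -
  define p p' q q' where "p = 1 - a" and "p' = 1 - a'" and "q = 1 - b" and "q' = 1 - b'"
  define e00 e01 e10 e11 where "e00 = 1 / (1 - s00)" and "e01 = 1 / (1 - s01)"
    and "e10 = 1 / (1 - s10)" and "e11 = 1 / (1 - s11)"
  have pos: "0 < 1 - s00" "0 < 1 - s01" "0 < 1 - s10" "0 < 1 - s11" using s a by auto
  have e: "0 < e00" "0 < e01" "0 < e10" "0 < e11"
    using pos by (auto simp: e00_def e01_def e10_def e11_def)
  have right: "q * e10 \<le> q' * e11"
    using bifree_quotient_mono[of 1 s11 s10 b b'] s b db
    by (simp add: e10_def e11_def q_def q'_def)
  define d0 d1 where "d0 = s00 - s10" and "d1 = s01 - s11"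
  have d: "0 \<le> d1" "d1 \<le> d0" "d0 \<le> p' - p"
    using s incr da by (auto simp: d0_def d1_def p_def p'_def)
  have de: "e00 - e10 = d0 * (e10 * e00)" "e01 - e11 = d1 * (e11 * e01)"
    using pos by (simp_all add: e00_def e01_def e10_def e11_def d0_def d1_def field_simps)
  (* Here a < 1 enters: (a - s) / (1 - s) decreases in s. *)
  have pe: "1 - p * e00 = e00 * (a - s00)" "1 - p * e01 = e01 * (a - s01)"
    using pos by (simp_all add: e00_def e01_def p_def field_simps)
  have excess: "e00 * (a - s00) \<le> e01 * (a - s01)"
  proof -
    have "(a - s01) * (1 - s00) - (a - s00) * (1 - s01) = (s00 - s01) * (1 - a)"
      by (simp add: algebra_simps)
    also have "0 \<le> \<dots>" using s a by (intro mult_nonneg_nonneg) auto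
    finally show ?thesis using pos by (simp add: e00_def e01_def field_simps)
  qed
  have key: "(q * e10) * (e00 * (a - s00)) \<le> (q' * e11) * (e01 * (a - s01))"
    by (rule mult_mono[OF right excess]) (use e b s in \<open>auto simp: q'_def\<close>)
  have "p * (q' * e11 - q * e10) - p * (q' * e01 - q * e00) =
    p * (q * (e00 - e10)) - p * (q' * (e01 - e11))"
    by (simp add: algebra_simps)
  also have "\<dots> = p * (q * (d0 * (e10 * e00))) - p * (q' * (d1 * (e11 * e01)))"
    unfolding de ..
  also have "\<dots> \<ge> p * (q * (d1 * (e10 * e00))) - p * (q' * (d1 * (e11 * e01)))"
    using a b d e by (intro diff_right_mono mult_left_mono mult_right_mono) (auto simp: p_def q_def)
  finally have 1: "p * (q * (d1 * (e10 * e00))) - p * (q' * (d1 * (e11 * e01)))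
    \<le> p * (q' * e11 - q * e10) - p * (q' * e01 - q * e00)" .
  have 2: "d1 * (q' * e11 - q * e10) \<le> (p' - p) * (q' * e11 - q * e10)"
    using d right by (intro mult_right_mono) auto
  have "d1 * (q' * e11 - q * e10) + (p * (q * (d1 * (e10 * e00))) - p * (q' * (d1 * (e11 * e01))))
    = d1 * ((q' * e11) * (1 - p * e01) - (q * e10) * (1 - p * e00))"
    by (simp add: algebra_simps)
  also have "\<dots> \<ge> 0"
    unfolding pe using d key by (intro mult_nonneg_nonneg) auto
  finally have "0 \<le> d1 * (q' * e11 - q * e10) +
    (p * (q * (d1 * (e10 * e00))) - p * (q' * (d1 * (e11 * e01))))" .
  with 1 2 have "0 \<le> (p' - p) * (q' * e11 - q * e10) + (p * (q' * e11 - q * e10) - p * (q' * e01 - q * e00))"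
    by linarith
  also have "\<dots> = p' * q' * e11 - p' * q * e10 - p * q' * e01 + p * q * e00"
    by (simp add: algebra_simps)
  finally show "(1 - a') * (1 - b) / (1 - s10) + (1 - a) * (1 - b') / (1 - s01)
    \<le> (1 - a) * (1 - b) / (1 - s00) + (1 - a') * (1 - b') / (1 - s11)"
    by (simp add: p_def p'_def q_def q'_def e00_def e01_def e10_def e11_def)
qed

section \<open>A bi-free distribution function with prescribed logarithm\<close>

lemma tendsto_powr_minus_ln:
  assumes "g > 0"
  shows "(\<lambda>n. real n * (1 - g powr (1 / real n))) \<longlonglongrightarrow> - ln (g :: real)"
proof -
  have "((\<lambda>h. exp (h * ln g)) has_field_derivative ln g) (at 0)"
    by (auto intro!: derivative_eq_intros)
  then have "((\<lambda>h. (exp (h * ln g) - 1) / h) \<longlongrightarrow> ln g) (at 0)"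
    by (simp add: has_field_derivative_iff)
  moreover have "filterlim (\<lambda>n. 1 / real n) (at 0) sequentially"
    unfolding filterlim_at using lim_1_over_n
    by (auto simp: eventually_sequentially intro!: exI[of _ 1])
  ultimately have "(\<lambda>n. (exp (1 / real n * ln g) - 1) / (1 / real n)) \<longlonglongrightarrow> ln g"
    by (rule filterlim_compose)
  then have "(\<lambda>n. - ((exp (1 / real n * ln g) - 1) / (1 / real n))) \<longlonglongrightarrow> - ln g"
    by (rule tendsto_minus)
  then show ?thesis using assms by (simp add: powr_def algebra_simps)
qed

text \<open>
  The functions \<open>V1\<close> and \<open>V2\<close> are the limits of \<open>V\<close> as the other coordinate tends to infinity.
\<close>

locale max_infdiv_quadrant =
  fixes G :: "real \<times> real \<Rightarrow> real" and l l' :: real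
  assumes G: "max_infdiv G" and supp: "{x. G x > 0} = {l..} \<times> {l'..}"
begin

definition V :: "real \<Rightarrow> real \<Rightarrow> real" where "V x y = - ln (G (x, y))"
definition V1 :: "real \<Rightarrow> real" where "V1 x = - ln (marginal1 G x)"
definition V2 :: "real \<Rightarrow> real" where "V2 y = - ln (marginal2 G y)"

lemma df: "bivariate_df G" using G by (simp add: max_infdiv_def)

lemma G_pos: "G (x, y) > 0 \<longleftrightarrow> l \<le> x \<and> l' \<le> y"
  using supp by auto

lemma marginal_pos: "l \<le> x \<Longrightarrow> marginal1 G x > 0" "l' \<le> y \<Longrightarrow> marginal2 G y > 0"
  using bivariate_df_le_marginal1[OF df, of x l'] bivariate_df_le_marginal2[OF df, of l y]
    G_pos[of x l'] G_pos[of l y] by auto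

lemma V1_nonneg: "l \<le> x \<Longrightarrow> 0 \<le> V1 x" and V2_nonneg: "l' \<le> y \<Longrightarrow> 0 \<le> V2 y"
  using marginal_pos(1)[of x] marginal_pos(2)[of y] marginal1_le_1[OF df, of x] marginal2_le_1[OF df, of y]
  by (auto simp: V1_def V2_def)

lemma V1_antimono: "l \<le> x \<Longrightarrow> x \<le> y \<Longrightarrow> V1 y \<le> V1 x"
  and V2_antimono: "l' \<le> x \<Longrightarrow> x \<le> y \<Longrightarrow> V2 y \<le> V2 x"
  using marginal_pos(1)[of x] marginal_pos(1)[of y] marginal1_mono[OF df, of x y]
    marginal_pos(2)[of x] marginal_pos(2)[of y] marginal2_mono[OF df, of x y]
  by (auto simp: V1_def V2_def)

lemma V_antimono: "l \<le> a \<Longrightarrow> l' \<le> c \<Longrightarrow> a \<le> b \<Longrightarrow> c \<le> d \<Longrightarrow> V b d \<le> V a c"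
  using G_pos[of a c] G_pos[of b d] bivariate_df_mono[OF df, of "(a, c)" "(b, d)"]
  by (simp add: V_def)

lemma V1_le_V: "l \<le> x \<Longrightarrow> l' \<le> y \<Longrightarrow> V1 x \<le> V x y"
  and V2_le_V: "l \<le> x \<Longrightarrow> l' \<le> y \<Longrightarrow> V2 y \<le> V x y"
  using G_pos[of x y] marginal_pos(1)[of x] marginal_pos(2)[of y] bivariate_df_le_marginal1[OF df, of x y]
    bivariate_df_le_marginal2[OF df, of x y]
  by (auto simp: V_def V1_def V2_def)

text \<open>
  The consequence of infinite divisibility of \<open>G\<close>: each \<open>n * (1 - G powr (1 / n))\<close> has the
  property, being built from a distribution function, and these functions converge to \<open>V\<close>.
\<close>

lemma V_2_decreasing:
  assumes "l \<le> a" "l' \<le> c" "a \<le> b" "c \<le> d"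
  shows "V a c + V b d \<le> V b c + V a d"
proof (rule LIMSEQ_le)
  let ?r = "\<lambda>n x. real n * (1 - G x powr (1 / real n))"
  have "(\<lambda>n. ?r n (x, y)) \<longlonglongrightarrow> V x y" if "l \<le> x" "l' \<le> y" for x y
    unfolding V_def using that by (intro tendsto_powr_minus_ln) (simp add: G_pos)
  then show "(\<lambda>n. ?r n (a, c) + ?r n (b, d)) \<longlonglongrightarrow> V a c + V b d"
    "(\<lambda>n. ?r n (b, c) + ?r n (a, d)) \<longlonglongrightarrow> V b c + V a d"
    using assms by (auto intro!: tendsto_add)
  have "?r n (a, c) + ?r n (b, d) \<le> ?r n (b, c) + ?r n (a, d)" if "n \<ge> 1" for n
  proof -
    have "bivariate_df (\<lambda>x. G x powr (1 / real n))"
      using G that by (simp add: max_infdiv_def)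
    from bivariate_df_2_increasing[OF this assms(3,4)] show ?thesis
      unfolding distrib_left[symmetric] by (intro mult_left_mono) auto
  qed
  then show "\<exists>N. \<forall>n\<ge>N. ?r n (a, c) + ?r n (b, d) \<le> ?r n (b, c) + ?r n (a, d)" by blast
qed

lemma V_tendsto_V1: "l \<le> x \<Longrightarrow> ((\<lambda>y. V x y) \<longlongrightarrow> V1 x) at_top"
  and V_tendsto_V2: "l' \<le> y \<Longrightarrow> ((\<lambda>x. V x y) \<longlongrightarrow> V2 y) at_top"
  unfolding V_def V1_def V2_def
  using marginal_pos(1)[of x] marginal_pos(2)[of y]
  by (auto intro!: tendsto_intros tendsto_marginal1 tendsto_marginal2 df)

lemma V1_at_top: "(V1 \<longlongrightarrow> 0) at_top" and V2_at_top: "(V2 \<longlongrightarrow> 0) at_top"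
  using tendsto_minus[OF tendsto_ln[OF marginal1_at_top[OF df]]]
    tendsto_minus[OF tendsto_ln[OF marginal2_at_top[OF df]]]
  by (simp_all add: V1_def[abs_def] V2_def[abs_def])

text \<open>
  The limiting case of \<open>V_2_decreasing\<close> for rectangles that are unbounded above.
\<close>

lemma V_V1_diff:
  assumes "l \<le> a" "a \<le> b" "l' \<le> c"
  shows "V a c + V1 b \<le> V b c + V1 a"
proof (rule tendsto_le)
  show "((\<lambda>d. V a c + V b d) \<longlongrightarrow> V a c + V1 b) at_top"
    "((\<lambda>d. V b c + V a d) \<longlongrightarrow> V b c + V1 a) at_top"
    using assms by (intro tendsto_intros V_tendsto_V1; simp)+
  show "eventually (\<lambda>d. V a c + V b d \<le> V b c + V a d) at_top"
    using V_2_decreasing[OF assms(1,3,2)] by (auto simp: eventually_at_top_linorder)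
qed simp

lemma V_V2_diff:
  assumes "l \<le> a" "l' \<le> c" "c \<le> d"
  shows "V a c + V2 d \<le> V a d + V2 c"
proof (rule tendsto_le)
  show "((\<lambda>b. V a c + V b d) \<longlongrightarrow> V a c + V2 d) at_top"
    "((\<lambda>b. V a d + V b c) \<longlongrightarrow> V a d + V2 c) at_top"
    using assms by (intro tendsto_intros V_tendsto_V2; simp)+
  show "eventually (\<lambda>b. V a c + V b d \<le> V a d + V b c) at_top"
    using V_2_decreasing[OF assms(1,2) _ assms(3)]
    by (auto simp: eventually_at_top_linorder add.commute)
qed simp

lemma V_diagonal: "(\<lambda>n. V (real n) (real n)) \<longlonglongrightarrow> 0"
proof -
  have "(\<lambda>n. G (real n, real n)) \<longlonglongrightarrow> 1"
  proof (rule tendsto_sandwich[OF _ _ _ tendsto_const])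
    have "(\<lambda>n. marginal1 G (real n) + marginal2 G (real n) - 1) \<longlonglongrightarrow> 1 + 1 - 1"
      by (intro tendsto_intros filterlim_compose[OF marginal1_at_top[OF df] filterlim_real_sequentially]
          filterlim_compose[OF marginal2_at_top[OF df] filterlim_real_sequentially])
    then show "(\<lambda>n. marginal1 G (real n) + marginal2 G (real n) - 1) \<longlonglongrightarrow> 1" by simp
  qed (auto simp: bivariate_df_ge_marginals[OF df] bivariate_df_le_1[OF df])
  from tendsto_minus[OF tendsto_ln[OF this]] show ?thesis by (simp add: V_def)
qed

text \<open>
  The solution of \<open>T_pos F = V / t\<close>.  Letting one coordinate tend to infinity shows that the
  marginals of \<open>F\<close> must be \<open>1 - V1 / t\<close> and \<open>1 - V2 / t\<close>, and then the equation determines \<open>F\<close>.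
\<close>

definition bifree_df :: "real \<Rightarrow> real \<times> real \<Rightarrow> real" where
  "bifree_df t = (\<lambda>(x, y). if l \<le> x \<and> l' \<le> y
     then (1 - V1 x / t) * (1 - V2 y / t) / (1 - (V1 x + V2 y - V x y) / t) else 0)"

text \<open>
  From this value on, the proposed marginals are positive on the whole closed quadrant.
\<close>

definition t_min :: real where "t_min = V1 l + V2 l' + 1"

lemma t_min_pos: "t_min > 0"
  using V1_nonneg[of l] V2_nonneg[of l'] by (simp add: t_min_def)

lemma V_less:
  assumes t: "t_min \<le> t" and x: "l \<le> x" and y: "l' \<le> y"
  shows "V1 x / t < 1" "V2 y / t < 1" "(V1 x + V2 y - V x y) / t < 1"
proof -
  have "V1 x < t" "V2 y < t" "V1 x + V2 y - V x y < t"
    using V1_antimono[of l x] V2_antimono[of l' y] V1_nonneg[of l] V2_nonneg[of l'] V2_le_V[OF x y] t x y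
    by (auto simp: t_min_def)
  then show "V1 x / t < 1" "V2 y / t < 1" "(V1 x + V2 y - V x y) / t < 1"
    using t t_min_pos by auto
qed

lemma bifree_df_pos_iff:
  assumes t: "t_min \<le> t"
  shows "bifree_df t (x, y) > 0 \<longleftrightarrow> l \<le> x \<and> l' \<le> y"
  using V_less[OF t, of x y] by (auto simp: bifree_df_def)

lemma bivariate_df_bifree_df:
  assumes t: "t_min \<le> t"
  shows "bivariate_df (bifree_df t)"
proof (rule bivariate_df_of_quadrant[of l l'])
  have t0: "t > 0" using t t_min_pos by simp
  let ?s = "\<lambda>x y. (V1 x + V2 y - V x y) / t"
  let ?f = "\<lambda>x y. (1 - V1 x / t) * (1 - V2 y / t) / (1 - ?s x y)"
  have eq: "bifree_df t (x, y) = ?f x y" if "l \<le> x" "l' \<le> y" for x y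
    using that by (simp add: bifree_df_def)
  show "bifree_df t (x, y) = 0" if "\<not> (l \<le> x \<and> l' \<le> y)" for x y
    using that by (auto simp: bifree_df_def)
  show "0 \<le> bifree_df t x" for x
    using bifree_df_pos_iff[OF t, of "fst x" "snd x"] by (cases x) (auto simp: bifree_df_def)
  have ineqs: "0 \<le> V1 b / t" "V1 b / t \<le> V1 a / t" "V1 a / t < 1"
    "0 \<le> V2 d / t" "V2 d / t \<le> V2 c / t" "V2 c / t < 1"
    "?s a c \<le> V1 a / t" "?s a c \<le> V2 c / t" "?s a d \<le> ?s a c" "?s b c \<le> ?s a c"
    "?s b d \<le> ?s a d" "?s b d \<le> ?s b c" "?s a d + ?s b c \<le> ?s a c + ?s b d"
    "?s a c - ?s b c \<le> V1 a / t - V1 b / t" "?s a c - ?s a d \<le> V2 c / t - V2 d / t"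
    "?s b c - ?s b d \<le> V2 c / t - V2 d / t" "?s a d - ?s b d \<le> V1 a / t - V1 b / t"
    if le: "l \<le> a" "a \<le> b" "l' \<le> c" "c \<le> d" for a b c d
    using le t0 V_less[OF t, of a c] V1_nonneg[of b] V2_nonneg[of d] V1_antimono[of a b]
      V2_antimono[of c d] V1_le_V[of a c] V2_le_V[of a c] V_V2_diff[of a c d] V_V1_diff[of a b c]
      V_V1_diff[of a b d] V_V2_diff[of b c d] V_2_decreasing[of a c b d]
      V_antimono[of a c b c] V_antimono[of a c a d] V_antimono[of b c b d] V_antimono[of a d b d]
    by (simp_all add: divide_right_mono flip: add_divide_distrib diff_divide_distrib)
  have incr: "?f b c + ?f a d \<le> ?f a c + ?f b d" "?f a c \<le> ?f a d"
    if le: "l \<le> a" "a \<le> b" "l' \<le> c" "c \<le> d" for a b c d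
    using ineqs[OF le]
    by (intro bifree_quotient_2_increasing bifree_quotient_mono; simp)+
  show "bifree_df t (b, c) + bifree_df t (a, d) \<le> bifree_df t (a, c) + bifree_df t (b, d)"
    if le: "l \<le> a" "a \<le> b" "l' \<le> c" "c \<le> d" for a b c d
    using incr(1)[OF le] le by (simp add: eq)
  show "bifree_df t (x, c) \<le> bifree_df t (x, d)" if le: "l \<le> x" "l' \<le> c" "c \<le> d" for x c d
    using incr(2)[of x x c d] le by (simp add: eq)
  show "bifree_df t (a, y) \<le> bifree_df t (b, y)" if le: "l \<le> a" "a \<le> b" "l' \<le> y" for a b y
  proof -
    have "(1 - V2 y / t) * (1 - V1 a / t) / (1 - ?s a y) \<le> (1 - V2 y / t) * (1 - V1 b / t) / (1 - ?s b y)"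
      using ineqs[of a b y y] le
      by (intro bifree_quotient_mono) auto
    then show ?thesis using le by (simp add: eq mult.commute)
  qed
  have lim: "((\<lambda>z. bifree_df t (h z, k z)) \<longlongrightarrow> bifree_df t (x, y)) (at_right v)"
    if xy: "l \<le> x" "l' \<le> y" and ev: "eventually (\<lambda>z. l \<le> h z \<and> l' \<le> k z) (at_right v)"
      and V: "((\<lambda>z. marginal1 G (h z)) \<longlongrightarrow> marginal1 G x) (at_right v)"
        "((\<lambda>z. marginal2 G (k z)) \<longlongrightarrow> marginal2 G y) (at_right v)"
        "((\<lambda>z. G (h z, k z)) \<longlongrightarrow> G (x, y)) (at_right v)"
    for x y v h k
  proof -
    have "((\<lambda>z. ?f (h z) (k z)) \<longlongrightarrow> ?f x y) (at_right v)"
      unfolding V_def V1_def V2_def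
      using marginal_pos(1)[of x] marginal_pos(2)[of y] xy G_pos[of x y] V_less(3)[OF t xy] t0
      by (intro tendsto_intros V) (auto simp: V_def V1_def V2_def)
    moreover have "eventually (\<lambda>z. ?f (h z) (k z) = bifree_df t (h z, k z)) (at_right v)"
      using ev by eventually_elim (simp add: eq)
    ultimately show ?thesis unfolding eq[OF xy] by (rule Lim_transform_eventually)
  qed
  show "continuous (at_right x) (\<lambda>x. bifree_df t (x, y))" if xy: "l \<le> x" "l' \<le> y" for x y
    unfolding continuous_within
    using xy marginal1_right_continuous[OF df, of x] bivariate_df_right_continuous(1)[OF df, of x y]
    by (intro lim)
       (auto simp: continuous_within eventually_at_right_field intro!: exI[of _ "x + 1"])
  show "continuous (at_right y) (\<lambda>y. bifree_df t (x, y))" if xy: "l \<le> x" "l' \<le> y" for x y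
    unfolding continuous_within
    using xy marginal2_right_continuous[OF df, of y] bivariate_df_right_continuous(2)[OF df, of y x]
    by (intro lim)
       (auto simp: continuous_within eventually_at_right_field intro!: exI[of _ "y + 1"])
  have "(\<lambda>n. ?f (real n) (real n)) \<longlonglongrightarrow> (1 - 0 / t) * (1 - 0 / t) / (1 - (0 + 0 - 0) / t)"
    using t0
    by (intro tendsto_intros V_diagonal filterlim_compose[OF V1_at_top filterlim_real_sequentially]
        filterlim_compose[OF V2_at_top filterlim_real_sequentially]) auto
  moreover obtain N where "max l l' \<le> real N" using real_arch_simple by blast
  then have "eventually (\<lambda>n. ?f (real n) (real n) = bifree_df t (real n, real n)) sequentially"
    by (intro eventually_sequentiallyI[of N]) (simp add: eq)
  ultimately show "(\<lambda>n. bifree_df t (real n, real n)) \<longlonglongrightarrow> 1"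
    by (simp add: tendsto_cong)
qed

lemma marginal1_bifree_df:
  assumes t: "t_min \<le> t"
  shows "marginal1 (bifree_df t) x = (if l \<le> x then 1 - V1 x / t else 0)"
proof (cases "l \<le> x")
  case True
  have "((\<lambda>y. (1 - V1 x / t) * (1 - V2 y / t) / (1 - (V1 x + V2 y - V x y) / t)) \<longlongrightarrow>
    (1 - V1 x / t) * (1 - 0 / t) / (1 - (V1 x + 0 - V1 x) / t)) at_top"
    using t t_min_pos True by (intro tendsto_intros V2_at_top V_tendsto_V1) auto
  moreover have "eventually (\<lambda>y. (1 - V1 x / t) * (1 - V2 y / t) / (1 - (V1 x + V2 y - V x y) / t)
    = bifree_df t (x, y)) at_top"
    using True by (auto simp: bifree_df_def eventually_at_top_linorder)
  ultimately have "((\<lambda>y. bifree_df t (x, y)) \<longlongrightarrow> 1 - V1 x / t) at_top"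
    by (simp add: tendsto_cong)
  then show ?thesis using True by (simp add: marginal1_def tendsto_Lim)
qed (simp add: marginal1_def bifree_df_def tendsto_Lim)

lemma marginal2_bifree_df:
  assumes t: "t_min \<le> t"
  shows "marginal2 (bifree_df t) y = (if l' \<le> y then 1 - V2 y / t else 0)"
proof (cases "l' \<le> y")
  case True
  have "((\<lambda>x. (1 - V1 x / t) * (1 - V2 y / t) / (1 - (V1 x + V2 y - V x y) / t)) \<longlongrightarrow>
    (1 - 0 / t) * (1 - V2 y / t) / (1 - (0 + V2 y - V2 y) / t)) at_top"
    using t t_min_pos True by (intro tendsto_intros V1_at_top V_tendsto_V2) auto
  moreover have "eventually (\<lambda>x. (1 - V1 x / t) * (1 - V2 y / t) / (1 - (V1 x + V2 y - V x y) / t)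
    = bifree_df t (x, y)) at_top"
    using True by (auto simp: bifree_df_def eventually_at_top_linorder)
  ultimately have "((\<lambda>x. bifree_df t (x, y)) \<longlongrightarrow> 1 - V2 y / t) at_top"
    by (simp add: tendsto_cong)
  then show ?thesis using True by (simp add: marginal2_def tendsto_Lim)
qed (simp add: marginal2_def bifree_df_def tendsto_Lim)

lemma bifree_df_ratio:
  assumes t: "t_min \<le> t" and xy: "l \<le> x" "l' \<le> y"
  shows "marginal1 (bifree_df t) x * marginal2 (bifree_df t) y / bifree_df t (x, y) =
    1 - (V1 x + V2 y - V x y) / t"
proof -
  have cancel: "p * q / (p * q / r) = r" if "p \<noteq> 0" "q \<noteq> 0" for p q r :: real
    using that by simp
  have m: "marginal1 (bifree_df t) x = 1 - V1 x / t" "marginal2 (bifree_df t) y = 1 - V2 y / t"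
    using xy by (simp_all add: marginal1_bifree_df[OF t] marginal2_bifree_df[OF t])
  have val: "bifree_df t (x, y) = (1 - V1 x / t) * (1 - V2 y / t) / (1 - (V1 x + V2 y - V x y) / t)"
    using xy by (simp add: bifree_df_def)
  show ?thesis
    unfolding m val by (rule cancel; use V_less[OF t xy] in linarith)
qed

text \<open>
  Both \<open>marginal - 1\<close> and \<open>marginal1 * marginal2 / F - 1\<close> are proportional to \<open>1 / t\<close> for
  \<open>F = bifree_df t\<close>, so that convolution adds the reciprocals of the parameters.
\<close>

lemma bifree_max_conv_bifree_df:
  assumes u: "t_min \<le> u" and v: "t_min \<le> v" and r: "t_min \<le> r" and urv: "1 / r = 1 / u + 1 / v"
  shows "bifree_max_conv (bifree_df u) (bifree_df v) (bifree_df r)"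
  unfolding bifree_max_conv_def
proof (intro conjI allI)
  have scale: "w / r = w / u + w / v" for w
    using arg_cong[OF urv, of "\<lambda>z. w * z"] by (simp add: distrib_left)
  show "marginal1 (bifree_df r) x = max (marginal1 (bifree_df u) x + marginal1 (bifree_df v) x - 1) 0" for x
    using V_less(1)[OF r, of x l'] scale[of "V1 x"]
    by (auto simp: marginal1_bifree_df[OF u] marginal1_bifree_df[OF v] marginal1_bifree_df[OF r] max_def)
  show "marginal2 (bifree_df r) y = max (marginal2 (bifree_df u) y + marginal2 (bifree_df v) y - 1) 0" for y
    using V_less(2)[OF r, of l y] scale[of "V2 y"]
    by (auto simp: marginal2_bifree_df[OF u] marginal2_bifree_df[OF v] marginal2_bifree_df[OF r] max_def)
  fix z :: "real \<times> real"
  obtain x y where z: "z = (x, y)" by fastforce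
  show "if bifree_df u z > 0 \<and> bifree_df v z > 0 \<and> marginal1 (bifree_df r) (fst z) > 0
      \<and> marginal2 (bifree_df r) (snd z) > 0
    then bifree_df r z > 0 \<and>
      marginal1 (bifree_df r) (fst z) * marginal2 (bifree_df r) (snd z) / bifree_df r z =
      marginal1 (bifree_df u) (fst z) * marginal2 (bifree_df u) (snd z) / bifree_df u z +
      marginal1 (bifree_df v) (fst z) * marginal2 (bifree_df v) (snd z) / bifree_df v z - 1
    else bifree_df r z = 0"
  proof (cases "l \<le> x \<and> l' \<le> y")
    case True
    then have "marginal1 (bifree_df r) x > 0" "marginal2 (bifree_df r) y > 0"
      using V_less[OF r, of x y] by (auto simp: marginal1_bifree_df[OF r] marginal2_bifree_df[OF r])
    then show ?thesis
      using True scale[of "V1 x + V2 y - V x y"]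
      by (simp add: z bifree_df_pos_iff u v r bifree_df_ratio)
  next
    case False
    then show ?thesis by (auto simp: z bifree_df_pos_iff u v r bifree_df_def)
  qed
qed (intro bivariate_df_bifree_df u v r)+

lemma bifree_max_power_bifree_df:
  assumes t: "t_min \<le> t" and n: "1 \<le> n"
  shows "bifree_max_power (bifree_df (real n * t)) n (bifree_df t)"
proof -
  have t0: "t > 0" using t t_min_pos by simp
  have "bifree_max_power (bifree_df (real n * t)) k (bifree_df (real n * t / k))"
    if "1 \<le> k" "k \<le> n" for k
    using that
  proof (induction k rule: dec_induct)
    case base
    then show ?case using bifree_max_power.one by simp
  next
    case (step k)
    have ge: "t_min \<le> real n * t / j" if "1 \<le> j" "j \<le> n" for j
    proof -
      have "t_min * real j \<le> t * real n"
        using t that t_min_pos t0 by (intro mult_mono) auto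
      then show ?thesis using that by (simp add: field_simps)
    qed
    show ?case
    proof (rule bifree_max_power.Suc[OF step.IH])
      show "bifree_max_conv (bifree_df (real n * t / k)) (bifree_df (real n * t)) (bifree_df (real n * t / Suc k))"
      proof (rule bifree_max_conv_bifree_df)
        show "1 / (real n * t / Suc k) = 1 / (real n * t / k) + 1 / (real n * t)"
          using step n t0 by (simp add: field_simps)
      qed (use ge[of k] ge[of 1] ge[of "Suc k"] step n in auto)
    qed (use step in auto)
  qed
  from this[of n] show ?thesis using n by simp
qed

lemma bifree_max_infdiv_bifree_df:
  assumes t: "t_min \<le> t"
  shows "bifree_max_infdiv (bifree_df t)"
  unfolding bifree_max_infdiv_def
proof (intro conjI allI impI)
  fix n :: nat assume n: "1 \<le> n"
  have "t \<le> real n * t" using n t t_min_pos by simp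
  then show "\<exists>R. bivariate_df R \<and> bifree_max_power R n (bifree_df t)"
    using bivariate_df_bifree_df bifree_max_power_bifree_df[OF t n] t by (meson order_trans)
qed (rule bivariate_df_bifree_df[OF t])

lemma inf_supp_bifree_df:
  assumes t: "t_min \<le> t"
  shows "inf_supp (bifree_df t) = (l, l')"
proof -
  have "{x. bifree_df t x > 0} = {l..} \<times> {l'..}" using bifree_df_pos_iff[OF t] by auto
  then have "supp_corner (bifree_df t) (l, l')" by (simp add: supp_corner_def)
  then show ?thesis
    unfolding inf_supp_def using supp_corner_unique by blast
qed

lemma exp_T_bifree_df:
  assumes t: "t_min \<le> t"
  shows "exp_T t (bifree_df t) (l, l') = G"
proof
  fix z :: "real \<times> real"
  obtain x y where z: "z = (x, y)" by fastforce
  show "exp_T t (bifree_df t) (l, l') z = G z"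
  proof (cases "l \<le> x \<and> l' \<le> y")
    case True
    then have "T_fun (bifree_df t) z =
      1 - (V1 x + V2 y - V x y) / t - (1 - V1 x / t) - (1 - V2 y / t) + 1"
      using bifree_df_ratio[OF t, of x y] bifree_df_pos_iff[OF t, of x y]
      by (simp only: T_fun_def T_pos_def z marginal1_bifree_df[OF t] marginal2_bifree_df[OF t]
          if_True fst_conv snd_conv simp_thms)
    also have "\<dots> = V x y / t" by (simp add: add_divide_distrib diff_divide_distrib)
    finally have "T_fun (bifree_df t) z = V x y / t" .
    then show ?thesis
      using True t t_min_pos G_pos[of x y] by (simp add: exp_T_def z V_def)
  next
    case False
    then have "G z = 0"
      using G_pos[of x y] bivariate_df_nonneg[OF df, of z] unfolding z by linarith
    then show ?thesis using False by (auto simp: exp_T_def z)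
  qed
qed

end

section \<open>The correspondence\<close>

theorem theorem7p3:
  "(\<forall>F. bifree_max_infdiv F \<longrightarrow> (\<forall>t>0. max_infdiv (exp_T t F (inf_supp F)))) \<and>
   (\<forall>G L. max_infdiv G \<and> {x. G x > 0} = {fst L..} \<times> {snd L..} \<longrightarrow>
      (\<exists>t>0. \<exists>F. bifree_max_infdiv F \<and> inf_supp F = L \<and> G = exp_T t F L))"
proof (intro conjI allI impI)
  fix F t assume "bifree_max_infdiv F" "(t :: real) > 0"
  then show "max_infdiv (exp_T t F (inf_supp F))"
    by (intro bifree_max_infdiv_df.max_infdiv_exp_T bifree_max_infdiv_df.intro)
next
  fix G :: "real \<times> real \<Rightarrow> real" and L
  assume "max_infdiv G \<and> {x. G x > 0} = {fst L..} \<times> {snd L..}"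
  then interpret max_infdiv_quadrant G "fst L" "snd L" by unfold_locales auto
  show "\<exists>t>0. \<exists>F. bifree_max_infdiv F \<and> inf_supp F = L \<and> G = exp_T t F L"
    using t_min_pos bifree_max_infdiv_bifree_df[OF order_refl] inf_supp_bifree_df[OF order_refl]
      exp_T_bifree_df[OF order_refl]
    by (intro exI[of _ t_min] exI[of _ "bifree_df t_min"] conjI) auto
qed

end
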